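(* Let $\hat\rho_{\rm loc}$ be any density matrix on $\mathcal H_{\rm loc}$, with spectral decomposition $\hat\rho_{\rm loc}=\sum_{k=1}^{d}\lambda_k|\psi_k\rangle\langle\psi_k|$ ($\{|\psi_k\rangle\}$ orthonormal), rank $r$, $\lambda_k\neq0$ for $k\le r$ and $\lambda_k=0$ for $k>r$. Let ${\rm Im}(\hat\rho_{\rm loc})={\rm span}\{|\psi_1\rangle,\dots,|\psi_r\rangle\}$, so ${\rm Im}(\hat\rho_{\rm loc}^{\otimes n})={\rm Im}(\hat\rho_{\rm loc})^{\otimes n}$, and let $\hat\Pi=\big(\sum_{k=1}^r|\psi_k\rangle\langle\psi_k|\big)^{\otimes n}$ be the orthogonal projection onto ${\rm Im}(\hat\rho_{\rm loc}^{\otimes n})$. Then $\mathcal L(\hat\rho_{\rm loc}^{\otimes n})=0$ if and only if the following four conditions hold simultaneously: (i) for all $i\in\Lambda$ and all $\alpha\in\Gamma_i$, $\hat L_i^{(\alpha)}\,{\rm Im}(\hat\rho_{\rm loc})\subset{\rm Im}(\hat\rho_{\rm loc})$; (ii) $\hat H_{\rm eff}\,{\rm Im}(\hat\rho_{\rm loc}^{\otimes n})\subset {\rm Im}(\hat\rho_{\rm loc}^{\otimes n})$, where $\hat H_{\rm eff}=\hat H-\frac{i}{2}\sum_{i\in\Lambda}\sum_{\alpha\in\Gamma_i}\hat L_i^{(\alpha)\dagger}\hat L_i^{(\alpha)}$; (iii) for all $i\in\Lambda$, $\mathcal P\mathcal L_i(\hat\rho_{\rm loc})=0$, where $\mathcal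 P\mathcal L_i(\bullet)=-i\big[\mathcal T'_i(\hat\Pi\hat H\hat\Pi),\bullet\big]+\sum_{\alpha\in\Gamma_i}\mathcal D_{\hat\Pi\hat L_i^{(\alpha)}\hat\Pi}(\bullet)$; (iv) for all $(i,j)\in\Lambda_2$, $\big[\mathcal T'_{ij}(\hat\Pi\hat H\hat\Pi),(\hat\rho_{\rm loc})_i\otimes(\hat\rho_{\rm loc})_j\big]=0$. Here $\hat\Pi\hat H\hat\Pi$ is regarded as an operator on ${\rm Im}(\hat\rho_{\rm loc})^{\otimes n}$, and $\mathcal T'_{ij},\mathcal T'_i$ are the maps $\mathcal T_{ij},\mathcal T_i$ defined in the context but computed on the space ${\rm Im}(\hat\rho_{\rm loc})^{\otimes n}$ (partial traces over ${\rm Im}(\hat\rho_{\rm loc})$ factors) with $d$ replaced by $r$.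
   Context: Setting: a lattice of $n$ sites labelled by $\Lambda=\{1,\dots,n\}$, with $\Lambda_2=\{(i,j):1\le i<j\le n\}$. Each site carries a copy of a finite-dimensional Hilbert space $\mathcal H_{\rm loc}$ of dimension $d$; the total space is $\mathcal H=\mathcal H_{\rm loc}^{\otimes n}$. For an operator $X$ on $\mathcal H_{\rm loc}$, $X_i$ (or $(X)_i$) denotes $X$ acting on site $i$. The dynamics is the GKSL equation $\frac{d\hat\rho}{dt}=\mathcal L(\hat\rho)=-i[\hat H,\hat\rho]+\sum_k\mathcal D_{\hat L_k}(\hat\rho)$ with $\mathcal D_{\hat L}(\rho)=\hat L\rho\hat L^\dagger-\frac12\{\hat L^\dagger\hat L,\rho\}$. Every Lindblad operator acts on a single site; those acting on site $i$ are denoted $\hat L_i^{(\alpha)}$, $\alpha\in\Gamma_i$. The Hamiltonian $\hat H$ is Hermitian and a sum of terms each acting on at most two sites. ${\rm Tr}_{\overline{ij}}$ (resp. ${\rm Tr}_{\overline i}$) denotes the partial trace over all sites other than $i,j$ (resp. other than $i$). Define $\mathcal T_{ij}(\hat H)=\frac{{\rm Tr}_{\overline{ij}}[\hat H]}{d^{n-2}}-\frac{{\rm Tr}_{\overline i}[\hat H]}{d^{n-1}}-\frac{{\rm Tr}_{\overline j}[\hat H]}{d^{n-1}}+\frac{{\rm Tr}[\hat H]}{d^n}$ and $\mathcal T_i(\hat H)=\frac{{\rm Tr}_{\overline i}[\hat H]}{d^{n-1}}-\frac{{\rm Tr}[\hat H]}{d^n}$ (each regarded as an operator on $\mathcal H$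 acting nontrivially on the indicated sites). *)

theory Defs
  imports Complex_Main
begin

(* Sites are natural numbers; a basis configuration of the sites in a set A is a
   function s :: nat => nat with s i < d for i in A and s i = 0 outside A.
   Operators on the sites A are matrices indexed by such configurations; only their
   entries at configurations in cfgs d A are meaningful. Local operators on
   H_loc = C^d are d x d matrices nat => nat => complex (indices < d). *)

type_synonym cfg = "nat \<Rightarrow> nat"
type_synonym mop = "cfg \<Rightarrow> cfg \<Rightarrow> complex"
type_synonym mvec = "cfg \<Rightarrow> complex"
type_synonym lop = "nat \<Rightarrow> nat \<Rightarrow> complex"
type_synonym lvec = "nat \<Rightarrow> complex"

definition cfgs :: "nat \<Rightarrow> nat set \<Rightarrow> cfg set" where
  "cfgs d A = {s. (\<forall>i\<in>A. s i < d) \<and> (\<forall>i. i \<notin> A \<longrightarrow> s i = 0)}"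

definition restr :: "nat set \<Rightarrow> cfg \<Rightarrow> cfg" where
  "restr A s = (\<lambda>i. if i \<in> A then s i else 0)"

definition merge :: "nat set \<Rightarrow> cfg \<Rightarrow> cfg \<Rightarrow> cfg" where
  "merge B s u = (\<lambda>i. if i \<in> B then s i else u i)"

definition op_eq :: "nat \<Rightarrow> nat set \<Rightarrow> mop \<Rightarrow> mop \<Rightarrow> bool" where
  "op_eq d A X Y \<longleftrightarrow> (\<forall>s\<in>cfgs d A. \<forall>t\<in>cfgs d A. X s t = Y s t)"

definition mmult :: "nat \<Rightarrow> nat set \<Rightarrow> mop \<Rightarrow> mop \<Rightarrow> mop" where
  "mmult d A X Y = (\<lambda>s t. \<Sum>u\<in>cfgs d A. X s u * Y u t)"

definition madj :: "mop \<Rightarrow> mop" where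
  "madj X = (\<lambda>s t. cnj (X t s))"

definition mcomm :: "nat \<Rightarrow> nat set \<Rightarrow> mop \<Rightarrow> mop \<Rightarrow> mop" where
  "mcomm d A X Y = (\<lambda>s t. mmult d A X Y s t - mmult d A Y X s t)"

definition dissip :: "nat \<Rightarrow> nat set \<Rightarrow> mop \<Rightarrow> mop \<Rightarrow> mop" where
  "dissip d A L R = (\<lambda>s t. mmult d A (mmult d A L R) (madj L) s t
      - 1/2 * (mmult d A (mmult d A (madj L) L) R s t + mmult d A R (mmult d A (madj L) L) s t))"

definition mtrace :: "nat \<Rightarrow> nat set \<Rightarrow> mop \<Rightarrow> complex" where
  "mtrace d A X = (\<Sum>s\<in>cfgs d A. X s s)"

definition ptrace :: "nat \<Rightarrow> nat set \<Rightarrow> nat set \<Rightarrow> mop \<Rightarrow> mop" where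
  "ptrace d A B X = (\<lambda>s t. \<Sum>u\<in>cfgs d (A - B). X (merge B s u) (merge B t u))"

definition lpow :: "nat set \<Rightarrow> lop \<Rightarrow> mop" where
  "lpow B e = (\<lambda>s t. \<Prod>i\<in>B. e (s i) (t i))"

definition mtensor :: "nat set \<Rightarrow> mop \<Rightarrow> nat set \<Rightarrow> mop \<Rightarrow> mop" where
  "mtensor A X B Y = (\<lambda>s t. X (restr A s) (restr A t) * Y (restr B s) (restr B t))"

definition lid :: lop where
  "lid = (\<lambda>a b. if a = b then 1 else 0)"

definition embed :: "nat set \<Rightarrow> nat set \<Rightarrow> mop \<Rightarrow> mop" where
  "embed Lam S h = mtensor S h (Lam - S) (lpow (Lam - S) lid)"

definition at_site :: "nat set \<Rightarrow> nat \<Rightarrow> lop \<Rightarrow> mop" where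
  "at_site Lam i X = embed Lam {i} (lpow {i} X)"

definition mapply :: "nat \<Rightarrow> nat set \<Rightarrow> mop \<Rightarrow> mvec \<Rightarrow> mvec" where
  "mapply d A X v = (\<lambda>s. \<Sum>t\<in>cfgs d A. X s t * v t)"

definition mimg :: "nat \<Rightarrow> nat set \<Rightarrow> mop \<Rightarrow> mvec set" where
  "mimg d A X = {w. \<exists>v. \<forall>s\<in>cfgs d A. w s = mapply d A X v s}"

definition lmult :: "nat \<Rightarrow> lop \<Rightarrow> lop \<Rightarrow> lop" where
  "lmult d X Y = (\<lambda>a b. \<Sum>c<d. X a c * Y c b)"

definition lapply :: "nat \<Rightarrow> lop \<Rightarrow> lvec \<Rightarrow> lvec" where
  "lapply d X v = (\<lambda>a. \<Sum>b<d. X a b * v b)"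

definition limg :: "nat \<Rightarrow> lop \<Rightarrow> lvec set" where
  "limg d X = {w. \<exists>v. \<forall>a<d. w a = lapply d X v a}"

definition linner :: "nat \<Rightarrow> lvec \<Rightarrow> lvec \<Rightarrow> complex" where
  "linner d v w = (\<Sum>a<d. cnj (v a) * w a)"

definition ltrace :: "nat \<Rightarrow> lop \<Rightarrow> complex" where
  "ltrace d X = (\<Sum>a<d. X a a)"

definition leq :: "nat \<Rightarrow> lop \<Rightarrow> lop \<Rightarrow> bool" where
  "leq d X Y \<longleftrightarrow> (\<forall>a<d. \<forall>b<d. X a b = Y a b)"

definition density_matrix :: "nat \<Rightarrow> lop \<Rightarrow> bool" where
  "density_matrix d \<rho> \<longleftrightarrow> (\<forall>a<d. \<forall>b<d. \<rho> a b = cnj (\<rho> b a))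
     \<and> (\<forall>v. 0 \<le> Re (linner d v (lapply d \<rho> v))) \<and> ltrace d \<rho> = 1"

definition lproj :: "(nat \<Rightarrow> lvec) \<Rightarrow> nat \<Rightarrow> lop" where
  "lproj \<psi> r = (\<lambda>a b. \<Sum>k<r. \<psi> k a * cnj (\<psi> k b))"

definition lindbladian :: "nat \<Rightarrow> nat set \<Rightarrow> mop \<Rightarrow> (nat \<Rightarrow> 'a set) \<Rightarrow> (nat \<Rightarrow> 'a \<Rightarrow> lop) \<Rightarrow> mop \<Rightarrow> mop" where
  "lindbladian d Lam H Gam L R = (\<lambda>s t. - \<i> * mcomm d Lam H R s t
      + (\<Sum>i\<in>Lam. \<Sum>\<alpha>\<in>Gam i. dissip d Lam (at_site Lam i (L i \<alpha>)) R s t))"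

definition heff :: "nat \<Rightarrow> nat set \<Rightarrow> mop \<Rightarrow> (nat \<Rightarrow> 'a set) \<Rightarrow> (nat \<Rightarrow> 'a \<Rightarrow> lop) \<Rightarrow> mop" where
  "heff d Lam H Gam L = (\<lambda>s t. H s t - \<i> / 2 * (\<Sum>i\<in>Lam. \<Sum>\<alpha>\<in>Gam i.
      mmult d Lam (madj (at_site Lam i (L i \<alpha>))) (at_site Lam i (L i \<alpha>)) s t))"

(* T_i and T_ij, parametrised by the local "identity" e and the dimension c.
   With e = lid, c = d these are the maps of the context; with e = the projection P onto
   Im(rho_loc) (the identity of Im(rho_loc)) and c = r they are the primed maps.
   Tsite gives an operator on the sites {i}, Tpair an operator on the sites {i,j}. *)
definition Tsite :: "nat \<Rightarrow> nat set \<Rightarrow> nat \<Rightarrow> lop \<Rightarrow> mop \<Rightarrow> nat \<Rightarrow> mop" where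
  "Tsite d Lam c e X i = (\<lambda>s t. ptrace d Lam {i} X s t / of_nat c ^ (card Lam - 1)
      - mtrace d Lam X / of_nat c ^ card Lam * e (s i) (t i))"

definition Tpair :: "nat \<Rightarrow> nat set \<Rightarrow> nat \<Rightarrow> lop \<Rightarrow> mop \<Rightarrow> nat \<Rightarrow> nat \<Rightarrow> mop" where
  "Tpair d Lam c e X i j = (\<lambda>s t. ptrace d Lam {i, j} X s t / of_nat c ^ (card Lam - 2)
      - ptrace d Lam {i} X (restr {i} s) (restr {i} t) / of_nat c ^ (card Lam - 1) * e (s j) (t j)
      - e (s i) (t i) * ptrace d Lam {j} X (restr {j} s) (restr {j} t) / of_nat c ^ (card Lam - 1)
      + mtrace d Lam X / of_nat c ^ card Lam * e (s i) (t i) * e (s j) (t j))"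

end

theory Submission
  imports Defs "Jordan_Normal_Form.Determinant"
begin

text \<open>
  Pass to the eigenbasis of \<open>\<rho>\<close>, where \<open>R = \<rho>\<^sup>\<otimes>\<^sup>n\<close> is diagonal. On the kernel of \<open>R\<close> the diagonal of
  the generator is \<open>\<Sum> L R L\<^sup>\<dagger>\<close>, whose vanishing is condition (i); then the off-diagonal block between
  kernel and support is \<open>-i H\<^sub>e\<^sub>f\<^sub>f R\<close>, whose vanishing is condition (ii), and what remains is the
  generator compressed to the support.

  On the support \<open>\<rho>\<close> is faithful. A two-local \<open>H\<close> is the sum of its parts \<open>T\<^sub>i\<^sub>j\<close>, \<open>T\<^sub>i\<close> and a constant, so
  the generator is a sum of terms \<open>G\<^sub>i \<otimes> \<rho>\<close> and \<open>F\<^sub>i\<^sub>j \<otimes> \<rho>\<close>, \<open>F\<^sub>i\<^sub>j = -i[T\<^sub>i\<^sub>j, \<rho> \<otimes> \<rho>]\<close>. Its diagonal entries,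
  divided by those of \<open>R\<close>, form a sum of functions of single sites, so each is constant, and zero as
  \<open>tr G\<^sub>i = 0\<close>. The same argument applied to the entries that differ at exactly one site uses
  \<open>tr\<^sub>j T\<^sub>i\<^sub>j = 0\<close>; entries that differ at exactly two sites see a single \<open>F\<^sub>i\<^sub>j\<close>.
\<close>

section \<open>Operators on configurations and change of basis\<close>

lemma finite_cfgs: "finite A \<Longrightarrow> finite (cfgs d A)"
proof -
  assume "finite A"
  then have "finite {f::cfg. \<forall>x. (x \<in> A \<longrightarrow> f x \<in> {..<d}) \<and> (x \<notin> A \<longrightarrow> f x = 0)}"
    by (intro finite_set_of_finite_funs) auto
  moreover have "{f::cfg. \<forall>x. (x \<in> A \<longrightarrow> f x \<in> {..<d}) \<and> (x \<notin> A \<longrightarrow> f x = 0)} = cfgs d A"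
    by (auto simp: cfgs_def)
  ultimately show ?thesis by simp
qed

lemma restr_cfgs: "s \<in> cfgs d A \<Longrightarrow> S \<subseteq> A \<Longrightarrow> restr S s \<in> cfgs d S"
  by (auto simp: cfgs_def restr_def)

lemma cfgs_mono: "r \<le> d \<Longrightarrow> cfgs r A \<subseteq> cfgs d A"
  by (auto simp: cfgs_def)

lemma cfgs_eq_iff:
  assumes "s \<in> cfgs d A" "t \<in> cfgs d' A"
  shows "s = t \<longleftrightarrow> (\<forall>i\<in>A. s i = t i)"
proof
  assume "\<forall>i\<in>A. s i = t i"
  then show "s = t"
    using assms by (intro ext, case_tac "x \<in> A") (auto simp: cfgs_def)
qed auto

text \<open>Since configurations are padded by 0 outside their set, \<open>merge\<close> and the
  pair of restrictions are mutually inverse. This is the index form of splitting a tensor product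
  into two factors.\<close>

lemma sum_cfgs_split:
  fixes f :: "cfg \<Rightarrow> 'b::comm_monoid_add"
  assumes "B \<subseteq> A"
  shows "(\<Sum>s\<in>cfgs d A. f s) = (\<Sum>p\<in>cfgs d B. \<Sum>q\<in>cfgs d (A - B). f (merge B p q))"
  unfolding sum.cartesian_product
  by (rule sum.reindex_bij_witness[where i = "\<lambda>(p, q). merge B p q"
        and j = "\<lambda>s. (restr B s, restr (A - B) s)"])
    (use assms in \<open>auto simp: cfgs_def merge_def restr_def fun_eq_iff intro!: arg_cong[where f = f]\<close>)

lemma cfgs_empty: "cfgs d {} = {\<lambda>_. 0}"
  by (auto simp: cfgs_def)

lemma sum_cfgs_singleton:
  fixes f :: "cfg \<Rightarrow> 'b::comm_monoid_add"
  shows "(\<Sum>s\<in>cfgs d {i}. f s) = (\<Sum>c<d. f ((\<lambda>_. 0)(i := c)))"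
  by (rule sum.reindex_bij_witness[where i = "\<lambda>c. (\<lambda>_. 0)(i := c)" and j = "\<lambda>s. s i"])
    (auto simp: cfgs_def fun_eq_iff intro!: arg_cong[where f = f])

text \<open>Distributivity over independent coordinates. It reduces products of tensor powers to a
  single site, and with \<open>f\<close> constantly 1 it counts configurations.\<close>

lemma sum_cfgs_prod:
  fixes f :: "nat \<Rightarrow> nat \<Rightarrow> complex"
  assumes "finite A"
  shows "(\<Sum>u\<in>cfgs d A. \<Prod>i\<in>A. f i (u i)) = (\<Prod>i\<in>A. \<Sum>c<d. f i c)"
  using assms
proof (induction A rule: finite_induct)
  case empty
  then show ?case by (simp add: cfgs_empty)
next
  case (insert j A)
  have "(\<Sum>u\<in>cfgs d (insert j A). \<Prod>i\<in>insert j A. f i (u i))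
    = (\<Sum>c<d. \<Sum>q\<in>cfgs d A. f j c * (\<Prod>i\<in>A. f i (q i)))"
    using insert.hyps
    by (subst sum_cfgs_split[of "{j}"], simp, subst sum_cfgs_singleton)
      (auto simp: merge_def intro!: sum.cong prod.cong)
  also have "\<dots> = (\<Sum>c<d. f j c) * (\<Prod>i\<in>A. \<Sum>c<d. f i c)"
    using insert.IH by (simp add: sum_distrib_left[symmetric] sum_distrib_right)
  finally show ?case using insert.hyps by simp
qed

lemma card_cfgs: "finite A \<Longrightarrow> card (cfgs d A) = d ^ card A"
proof -
  assume "finite A"
  from sum_cfgs_prod[OF this, of "\<lambda>_ _. 1" d]
  have "of_nat (card (cfgs d A)) = (of_nat (d ^ card A) :: complex)" by simp
  then show ?thesis by (metis of_nat_eq_iff)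
qed

lemma sum_cfgs_restr:
  fixes g :: "cfg \<Rightarrow> complex"
  assumes "finite A" "B \<subseteq> A"
  shows "(\<Sum>u\<in>cfgs d A. g (restr B u)) = of_nat d ^ card (A - B) * (\<Sum>u\<in>cfgs d B. g u)"
proof -
  have *: "restr B (merge B p q) = p" if "p \<in> cfgs d B" for p q
    using that by (auto simp: restr_def merge_def cfgs_def)
  show ?thesis
    using assms by (simp add: sum_cfgs_split[of B A] * card_cfgs sum_distrib_left)
qed

section \<open>Matrix products, tensor products and adjoints\<close>

lemma mmult_assoc: "mmult c B (mmult d A X Y) Z = mmult d A X (mmult c B Y Z)"
  unfolding mmult_def
  by (intro ext) (simp only: sum_distrib_left sum_distrib_right mult.assoc, rule sum.swap)

lemma mmult_cong:
  assumes "\<And>u. u \<in> cfgs d A \<Longrightarrow> X s u = X' s u" "\<And>u. u \<in> cfgs d A \<Longrightarrow> Y u t = Y' u t"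
  shows "mmult d A X Y s t = mmult d A X' Y' s t"
  unfolding mmult_def using assms by (auto intro: sum.cong)

lemma lpow_lid: "finite A \<Longrightarrow> lpow A lid s t = of_bool (\<forall>i\<in>A. s i = t i)"
  by (auto simp: lpow_def lid_def intro!: prod.neutral)

lemma lpow_lid_cfgs:
  assumes "finite A" "s \<in> cfgs d A" "t \<in> cfgs d' A"
  shows "lpow A lid s t = of_bool (s = t)"
  using lpow_lid[OF assms(1)] cfgs_eq_iff[OF assms(2,3)] by simp

lemma lpow_cong:
  assumes "\<And>i. i \<in> A \<Longrightarrow> e (s i) (t i) = e' (s i) (t i)"
  shows "lpow A e s t = lpow A e' s t"
  unfolding lpow_def using assms by (auto intro: prod.cong)

lemma lpow_cong_cfgs:
  assumes "s \<in> cfgs d A" "t \<in> cfgs d' A" "\<And>a b. a < d \<Longrightarrow> b < d' \<Longrightarrow> e a b = e' a b"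
  shows "lpow A e s t = lpow A e' s t"
  by (rule lpow_cong) (use assms in \<open>auto simp: cfgs_def\<close>)

lemma mmult_lid_right:
  assumes "finite A" "t \<in> cfgs d A"
  shows "mmult d A X (lpow A lid) s t = X s t"
proof -
  have "mmult d A X (lpow A lid) s t = (\<Sum>u\<in>cfgs d A. if u = t then X s u else 0)"
    unfolding mmult_def using assms by (auto intro!: sum.cong simp: lpow_lid_cfgs)
  then show ?thesis using assms finite_cfgs by (simp add: sum.delta')
qed

lemma mmult_lid_left:
  assumes "finite A" "s \<in> cfgs d A"
  shows "mmult d A (lpow A lid) X s t = X s t"
proof -
  have "mmult d A (lpow A lid) X s t = (\<Sum>u\<in>cfgs d A. if s = u then X u t else 0)"
    unfolding mmult_def using assms by (auto intro!: sum.cong simp: lpow_lid_cfgs)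
  then show ?thesis using assms finite_cfgs by (simp add: sum.delta)
qed

lemma mmult_lpow: "finite A \<Longrightarrow> mmult d A (lpow A X) (lpow A Y) = lpow A (lmult d X Y)"
  unfolding mmult_def lpow_def lmult_def
  by (intro ext) (simp add: prod.distrib[symmetric] sum_cfgs_prod[where f = "\<lambda>i c. X (s i) c * Y c (t i)" for s t])

definition ladj :: "lop \<Rightarrow> lop" where
  "ladj X = (\<lambda>a b. cnj (X b a))"

lemma ladj_ladj [simp]: "ladj (ladj X) = X"
  by (simp add: ladj_def)

lemma madj_lpow: "madj (lpow A X) = lpow A (ladj X)"
  by (simp add: madj_def lpow_def ladj_def)

lemma madj_mmult: "madj (mmult d A X Y) = mmult d A (madj Y) (madj X)"
  by (simp add: madj_def mmult_def mult.commute)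

lemma lmult_assoc: "lmult c (lmult d X Y) Z = lmult d X (lmult c Y Z)"
  unfolding lmult_def
  by (intro ext) (simp only: sum_distrib_left sum_distrib_right mult.assoc, rule sum.swap)

lemma restr_merge_left: "p \<in> cfgs d S \<Longrightarrow> restr S (merge S p q) = p"
  by (auto simp: restr_def merge_def cfgs_def)

lemma restr_merge_right: "q \<in> cfgs d T \<Longrightarrow> S \<inter> T = {} \<Longrightarrow> restr T (merge S p q) = q"
  by (auto simp: restr_def merge_def cfgs_def fun_eq_iff)

lemma mmult_mtensor:
  assumes "S \<inter> T = {}"
  shows "mmult d (S \<union> T) (mtensor S X T Y) (mtensor S X' T Y')
    = mtensor S (mmult d S X X') T (mmult d T Y Y')"
proof (intro ext)
  fix s t
  have T: "S \<union> T - S = T" using assms by auto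
  have "mmult d (S \<union> T) (mtensor S X T Y) (mtensor S X' T Y') s t
    = (\<Sum>p\<in>cfgs d S. \<Sum>q\<in>cfgs d T. (X (restr S s) p * X' p (restr S t)) * (Y (restr T s) q * Y' q (restr T t)))"
    unfolding mmult_def
    by (subst sum_cfgs_split[of S], simp)
      (use assms in \<open>auto intro!: sum.cong simp: T mtensor_def restr_merge_left restr_merge_right\<close>)
  also have "\<dots> = mtensor S (mmult d S X X') T (mmult d T Y Y') s t"
    by (simp add: mtensor_def mmult_def sum_product)
  finally show "mmult d (S \<union> T) (mtensor S X T Y) (mtensor S X' T Y') s t
    = mtensor S (mmult d S X X') T (mmult d T Y Y') s t" .
qed

lemma madj_mtensor: "madj (mtensor S X T Y) = mtensor S (madj X) T (madj Y)"
  by (simp add: madj_def mtensor_def)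

lemma lpow_restr: "lpow S e (restr S s) (restr S t) = lpow S e s t"
  by (auto simp: lpow_def restr_def intro: prod.cong)

lemma lpow_mtensor:
  assumes "S \<inter> T = {}" "finite S" "finite T"
  shows "lpow (S \<union> T) e = mtensor S (lpow S e) T (lpow T e)"
  using assms by (intro ext) (simp add: mtensor_def lpow_restr, simp add: lpow_def prod.union_disjoint)

text \<open>With \<open>V = U\<^sup>\<otimes>\<^sup>A\<close> this is \<open>V Y V\<^sup>\<dagger>\<close> for a possibly rectangular \<open>U\<close> with
  \<open>r\<close> columns; \<open>cj d A (ladj U)\<close> passes to matrix elements in the basis given by the
  columns of \<open>U\<close>.\<close>

definition cj :: "nat \<Rightarrow> nat set \<Rightarrow> lop \<Rightarrow> mop \<Rightarrow> mop" where
  "cj r A U Y = mmult r A (mmult r A (lpow A U) Y) (lpow A (ladj U))"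

text \<open>Only the first \<open>r\<close> columns are constrained, so one matrix \<open>U\<close>
  can serve as a unitary (\<open>r = d\<close>) and, by \<open>isometry_mono\<close>, as an isometry
  from C^r into C^d.\<close>

definition isometry :: "nat \<Rightarrow> nat \<Rightarrow> lop \<Rightarrow> bool" where
  "isometry d r U \<longleftrightarrow> (\<forall>k<r. \<forall>l<r. lmult d (ladj U) U k l = lid k l)"

lemma isometry_mono: "isometry d r' U \<Longrightarrow> r \<le> r' \<Longrightarrow> isometry d r U"
  by (auto simp: isometry_def)

lemma isometry_lpow:
  assumes "isometry d r U" "finite A" "s \<in> cfgs r A" "t \<in> cfgs r A"
  shows "mmult d A (lpow A (ladj U)) (lpow A U) s t = lpow A lid s t"
  using assms by (simp add: mmult_lpow) (rule lpow_cong_cfgs[of _ r _ _ r], auto simp: isometry_def)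

text \<open>The inner factors meet in V^dagger V, which is the identity on \<open>cfgs r A\<close>.
  Hence conjugation is multiplicative even when V is rectangular and V V^dagger is only a
  projection; \<open>mmult_assoc\<close> admits different index ranges for this reason.\<close>

lemma mmult_cj:
  assumes "isometry d r U" "finite A"
  shows "mmult d A (cj r A U Y) (cj r A U Z) = cj r A U (mmult r A Y Z)"
proof (intro ext)
  fix s t
  let ?V = "lpow A U" and ?W = "lpow A (ladj U)"
  have in1: "mmult r A (mmult d A ?W ?V) B u v = B u v" if "u \<in> cfgs r A" for B u v
  proof -
    have "mmult r A (mmult d A ?W ?V) B u v = mmult r A (lpow A lid) B u v"
      by (rule mmult_cong) (use isometry_lpow[OF assms] that in auto)
    then show ?thesis using that assms(2) by (simp add: mmult_lid_left)
  qed
  have "mmult d A (cj r A U Y) (cj r A U Z) s t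
    = mmult r A (mmult r A ?V Y) (mmult r A (mmult d A ?W ?V) (mmult r A Z ?W)) s t"
    by (simp add: cj_def mmult_assoc)
  also have "\<dots> = mmult r A (mmult r A ?V Y) (mmult r A Z ?W) s t"
    by (rule mmult_cong) (simp_all add: in1)
  finally show "mmult d A (cj r A U Y) (cj r A U Z) s t = cj r A U (mmult r A Y Z) s t"
    by (simp add: cj_def mmult_assoc)
qed

lemma cj_cj:
  assumes "isometry d r U" "finite A" "s \<in> cfgs r A" "t \<in> cfgs r A"
  shows "cj d A (ladj U) (cj r A U Y) s t = Y s t"
proof -
  let ?V = "lpow A U" and ?W = "lpow A (ladj U)"
  have "cj d A (ladj U) (cj r A U Y) s t
    = mmult r A (mmult d A ?W ?V) (mmult r A Y (mmult d A ?W ?V)) s t"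
    by (simp add: cj_def mmult_assoc)
  also have "\<dots> = mmult r A (lpow A lid) (mmult r A Y (lpow A lid)) s t"
    using isometry_lpow[OF assms(1,2)] assms(3,4) by (intro mmult_cong) auto
  finally show ?thesis using assms by (simp add: mmult_lid_left mmult_lid_right)
qed

lemma cj_cong:
  assumes "op_eq r A Y Y'"
  shows "cj r A U Y = cj r A U Y'"
  unfolding cj_def using assms by (intro ext mmult_cong) (auto simp: op_eq_def)

lemma cj_mtensor:
  assumes "S \<inter> T = {}" "finite S" "finite T"
  shows "cj r (S \<union> T) U (mtensor S X T Y) = mtensor S (cj r S U X) T (cj r T U Y)"
  unfolding cj_def using assms by (simp add: lpow_mtensor mmult_mtensor)

lemma cj_lpow: "finite A \<Longrightarrow> cj r A U (lpow A e) = lpow A (lmult r (lmult r U e) (ladj U))"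
  by (simp add: cj_def mmult_lpow)

lemma madj_cj: "madj (cj r A U Y) = cj r A U (madj Y)"
  by (simp add: cj_def madj_mmult madj_lpow mmult_assoc)

lemma cj_entry:
  "cj r A U Y s t = (\<Sum>x\<in>cfgs r A. \<Sum>y\<in>cfgs r A. lpow A U s x * Y x y * cnj (lpow A U t y))"
  unfolding cj_def madj_lpow[symmetric]
  by (simp only: mmult_def madj_def sum_distrib_right) (rule sum.swap)

lemma cj_lin:
  "cj r A U (\<lambda>s t. X s t + Y s t) = (\<lambda>s t. cj r A U X s t + cj r A U Y s t)"
  "cj r A U (\<lambda>s t. X s t - Y s t) = (\<lambda>s t. cj r A U X s t - cj r A U Y s t)"
  "cj r A U (\<lambda>s t. c * X s t) = (\<lambda>s t. c * cj r A U X s t)"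
  "cj r A U (\<lambda>s t. X s t / c) = (\<lambda>s t. cj r A U X s t / c)"
  "cj r A U (\<lambda>s t. \<Sum>m\<in>M. F m s t) = (\<lambda>s t. \<Sum>m\<in>M. cj r A U (F m) s t)"
  by (auto simp: cj_entry fun_eq_iff algebra_simps sum.distrib sum_subtractf sum_distrib_left
      sum_divide_distrib sum.swap[of _ M])

text \<open>By \<open>cj_cj\<close> the conjugation has a left inverse, hence is injective.
  Equations can thus be tested either on the \<open>r\<close>-dimensional space or on its
  image.\<close>

lemma op_eq_cj_iff:
  assumes "isometry d r U" "finite A"
  shows "op_eq d A (cj r A U Z) (\<lambda>_ _. 0) \<longleftrightarrow> op_eq r A Z (\<lambda>_ _. 0)"
proof
  assume "op_eq d A (cj r A U Z) (\<lambda>_ _. 0)"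
  then have "cj d A (ladj U) (cj r A U Z) = cj d A (ladj U) (\<lambda>_ _. 0)" by (rule cj_cong)
  also have "\<dots> = (\<lambda>_ _. 0)" by (simp add: cj_entry fun_eq_iff)
  finally have z: "cj d A (ladj U) (cj r A U Z) = (\<lambda>_ _. 0)" .
  show "op_eq r A Z (\<lambda>_ _. 0)"
    unfolding op_eq_def using cj_cj[OF assms, of _ _ Z] by (simp add: z)
next
  assume "op_eq r A Z (\<lambda>_ _. 0)"
  then show "op_eq d A (cj r A U Z) (\<lambda>_ _. 0)"
    by (simp add: cj_cong[of r A Z "\<lambda>_ _. 0"] op_eq_def) (simp add: cj_entry)
qed

lemma mcomm_cj:
  assumes "isometry d r U" "finite A"
  shows "mcomm d A (cj r A U Y) (cj r A U Z) = cj r A U (mcomm r A Y Z)"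
  unfolding mcomm_def cj_lin by (simp add: mmult_cj[OF assms])

lemma dissip_cj:
  assumes "isometry d r U" "finite A"
  shows "dissip d A (cj r A U Y) (cj r A U Z) = cj r A U (dissip r A Y Z)"
  unfolding dissip_def cj_lin by (simp add: mmult_cj[OF assms] madj_cj)

lemma mcomm_cong:
  assumes "op_eq d A X X'" "op_eq d A Y Y'"
  shows "op_eq d A (mcomm d A X Y) (mcomm d A X' Y')"
  using assms unfolding op_eq_def mcomm_def by (auto intro!: arg_cong2[where f = minus] mmult_cong)

lemma mmult_cong_op_eq:
  assumes "op_eq d A X X'" "op_eq d A Y Y'"
  shows "op_eq d A (mmult d A X Y) (mmult d A X' Y')"
  using assms unfolding op_eq_def by (auto intro!: mmult_cong)

lemma madj_cong: "op_eq d A X X' \<Longrightarrow> op_eq d A (madj X) (madj X')"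
  by (simp add: op_eq_def madj_def)

lemma dissip_cong:
  assumes "op_eq d A X X'" "op_eq d A Y Y'"
  shows "op_eq d A (dissip d A X Y) (dissip d A X' Y')"
proof -
  note c = mmult_cong_op_eq madj_cong assms
  have "op_eq d A (mmult d A (mmult d A X Y) (madj X)) (mmult d A (mmult d A X' Y') (madj X'))"
    "op_eq d A (mmult d A (mmult d A (madj X) X) Y) (mmult d A (mmult d A (madj X') X') Y')"
    "op_eq d A (mmult d A Y (mmult d A (madj X) X)) (mmult d A Y' (mmult d A (madj X') X'))"
    by (intro c)+
  then show ?thesis by (simp add: op_eq_def dissip_def)
qed

text \<open>V factorises into a part on \<open>B\<close> and a part on \<open>A - B\<close>. The
  columns of the latter are orthonormal, so tracing out \<open>A - B\<close> in C^d equals tracing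
  it out in C^r. This identifies partial traces over factors of the image of \<open>\<rho>\<close>
  with partial traces over \<open>cfgs r\<close>.\<close>

lemma ptrace_cj:
  assumes U: "isometry d r U" and fin: "finite A" and B: "B \<subseteq> A"
  shows "ptrace d A B (cj r A U Y) = cj r B U (ptrace r A B Y)"
proof (intro ext)
  fix s t
  have finB: "finite B" "finite (A - B)" using fin B finite_subset by auto
  let ?C = "cfgs r B" and ?D = "cfgs r (A - B)" and ?E = "cfgs d (A - B)"
  have spl: "lpow A U (merge B s u) (merge B p q) = lpow B U s p * lpow (A - B) U u q" for s u p q
  proof -
    have "lpow A U (merge B s u) (merge B p q) = (\<Prod>i\<in>B \<union> (A - B). U (merge B s u i) (merge B p q i))"
      using B by (simp add: lpow_def Un_absorb1)
    also have "\<dots> = lpow B U s p * lpow (A - B) U u q"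
      using finB by (subst prod.union_disjoint) (auto simp: lpow_def merge_def)
    finally show ?thesis .
  qed
  have orth: "(\<Sum>u\<in>?E. lpow (A - B) U u q * cnj (lpow (A - B) U u q')) = of_bool (q' = q)"
    if "q \<in> ?D" "q' \<in> ?D" for q q'
    using isometry_lpow[OF U finB(2) that(2,1)] lpow_lid_cfgs[OF finB(2) that(2,1)]
    by (simp add: mmult_def madj_lpow[symmetric] madj_def mult.commute)
  have "ptrace d A B (cj r A U Y) s t = (\<Sum>u\<in>?E. \<Sum>p\<in>?C. \<Sum>q\<in>?D. \<Sum>p'\<in>?C. \<Sum>q'\<in>?D.
      (lpow B U s p * Y (merge B p q) (merge B p' q') * cnj (lpow B U t p'))
       * (lpow (A - B) U u q * cnj (lpow (A - B) U u q')))"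
    unfolding ptrace_def cj_entry
    by (simp add: sum_cfgs_split[OF B] spl algebra_simps)
  also have "\<dots> = (\<Sum>p\<in>?C. \<Sum>q\<in>?D. \<Sum>p'\<in>?C. \<Sum>q'\<in>?D. \<Sum>u\<in>?E.
      (lpow B U s p * Y (merge B p q) (merge B p' q') * cnj (lpow B U t p'))
       * (lpow (A - B) U u q * cnj (lpow (A - B) U u q')))"
    by (simp only: sum.swap[of _ _ ?E])
  also have "\<dots> = (\<Sum>p\<in>?C. \<Sum>q\<in>?D. \<Sum>p'\<in>?C. \<Sum>q'\<in>?D.
      if q' = q then lpow B U s p * Y (merge B p q) (merge B p' q') * cnj (lpow B U t p') else 0)"
    by (auto intro!: sum.cong simp: sum_distrib_left[symmetric] orth)
  also have "\<dots> = (\<Sum>p\<in>?C. \<Sum>q\<in>?D. \<Sum>p'\<in>?C. lpow B U s p * Y (merge B p q) (merge B p' q) * cnj (lpow B U t p'))"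
    using finite_cfgs[OF finB(2)] by simp
  also have "\<dots> = cj r B U (ptrace r A B Y) s t"
    unfolding ptrace_def cj_entry
    by (rule sum.cong[OF refl]) (simp only: sum_distrib_left sum_distrib_right, rule sum.swap)
  finally show "ptrace d A B (cj r A U Y) s t = cj r B U (ptrace r A B Y) s t" .
qed

lemma ptrace_empty: "ptrace d A {} X s t = mtrace d A X"
  by (simp add: ptrace_def mtrace_def merge_def)

lemma mtrace_cj:
  assumes "isometry d r U" "finite A"
  shows "mtrace d A (cj r A U Y) = mtrace r A Y"
  using ptrace_cj[OF assms, of "{}" Y] ptrace_empty[of d A "cj r A U Y"] ptrace_empty[of r A Y]
  by (simp add: fun_eq_iff cj_entry cfgs_empty lpow_def)

text \<open>For square matrices a left inverse is a right inverse, so U^dagger U = 1 yields U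
  U^dagger = 1.\<close>

lemma isometry_ladj:
  assumes "isometry d d U"
  shows "isometry d d (ladj U)"
proof -
  define M where "M = mat d d (\<lambda>(a, b). U a b)"
  define N where "N = mat d d (\<lambda>(a, b). ladj U a b)"
  have c: "M \<in> carrier_mat d d" "N \<in> carrier_mat d d" by (auto simp: M_def N_def)
  have "N * M = 1\<^sub>m d"
    using assms by (intro eq_matI) (auto simp: M_def N_def isometry_def lmult_def lid_def scalar_prod_def
        lessThan_atLeast0)
  then have *: "M * N = 1\<^sub>m d" using mat_mult_left_right_inverse[OF c(2,1)] by simp
  have "lmult d U (ladj U) k l = lid k l" if "k < d" "l < d" for k l
  proof -
    have "lmult d U (ladj U) k l = (M * N) $$ (k, l)"
      using that by (auto simp: M_def N_def lmult_def scalar_prod_def lessThan_atLeast0)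
    then show ?thesis using that by (simp add: * lid_def)
  qed
  then show ?thesis by (simp add: isometry_def)
qed

section \<open>Decomposition of two-local operators\<close>

lemma embed_entry:
  assumes "finite A"
  shows "embed A S h s t = h (restr S s) (restr S t) * of_bool (\<forall>i\<in>A - S. s i = t i)"
  using assms by (simp add: embed_def mtensor_def lpow_restr lpow_lid)

lemma ptrace_restr: "ptrace d A B X (restr B s) (restr B t) = ptrace d A B X s t"
proof -
  have "merge B (restr B s) u = merge B s u" for s u
    by (auto simp: merge_def restr_def)
  then show ?thesis by (simp add: ptrace_def)
qed

text \<open>The normalised conditional expectation onto the operators supported on \<open>B\<close>.\<close>

definition avg :: "nat \<Rightarrow> nat set \<Rightarrow> nat set \<Rightarrow> mop \<Rightarrow> mop" where
  "avg r A B X s t = ptrace r A B X s t / of_nat r ^ card (A - B) * of_bool (\<forall>i\<in>A - B. s i = t i)"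

text \<open>The traced sites split into those of \<open>S - B\<close>, where \<open>h\<close> is
  really averaged, and those outside \<open>B \<union> S\<close>, where the identity contributes a
  power of \<open>r\<close> that the normalisation cancels.\<close>

lemma avg_embed:
  assumes "finite A" "S \<subseteq> A" "B \<subseteq> A" "r > 0"
  shows "avg r A B (embed A S h) s t
    = (\<Sum>u\<in>cfgs r (S - B). h (merge (B \<inter> S) s u) (merge (B \<inter> S) t u)) / of_nat r ^ card (S - B)
      * of_bool (\<forall>i\<in>A - B \<inter> S. s i = t i)"
proof -
  let ?b = "of_bool (\<forall>i\<in>(A - S) \<inter> B. s i = t i) :: complex"
  let ?g = "\<lambda>u. h (merge (B \<inter> S) s u) (merge (B \<inter> S) t u)"
  have r: "restr S (merge B s u) = merge (B \<inter> S) s (restr (S - B) u)" for s u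
    by (auto simp: merge_def restr_def)
  have dl: "(\<forall>i\<in>A - S. merge B s u i = merge B t u i) \<longleftrightarrow> (\<forall>i\<in>(A - S) \<inter> B. s i = t i)" for u
    by (auto simp: merge_def)
  have ds: "A - B - (S - B) = A - (B \<union> S)" by auto
  have "ptrace r A B (embed A S h) s t = (\<Sum>u\<in>cfgs r (A - B). ?g (restr (S - B) u)) * ?b"
    unfolding ptrace_def embed_entry[OF assms(1)] r dl by (simp add: sum_distrib_right)
  also have "\<dots> = of_nat r ^ card (A - (B \<union> S)) * (\<Sum>u\<in>cfgs r (S - B). ?g u) * ?b"
    using sum_cfgs_restr[of "A - B" "S - B" ?g r] assms ds by (auto simp: Diff_mono)
  finally have p: "ptrace r A B (embed A S h) s t
    = of_nat r ^ card (A - (B \<union> S)) * (\<Sum>u\<in>cfgs r (S - B). ?g u) * ?b" .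
  have "A - B = (A - (B \<union> S)) \<union> (S - B)" using assms by auto
  moreover have "card ((A - (B \<union> S)) \<union> (S - B)) = card (A - (B \<union> S)) + card (S - B)"
    using assms by (intro card_Un_disjoint) (auto intro: finite_subset)
  ultimately have c: "card (A - B) = card (A - (B \<union> S)) + card (S - B)" by simp
  have "?b * of_bool (\<forall>i\<in>A - B. s i = t i) = of_bool (\<forall>i\<in>A - B \<inter> S. s i = t i)"
    by auto
  then show ?thesis
    unfolding avg_def p c using assms(4)
    by (auto simp: power_add)
qed

text \<open>The formula of \<open>avg_embed\<close> sees \<open>B\<close> only through
  \<open>B \<inter> S\<close> and \<open>S - B\<close>. This supplies the hypothesis on
  \<open>f\<close> in \<open>mobius_two_body\<close>.\<close>

lemma avg_embed_inter:
  assumes "finite A" "S \<subseteq> A" "B \<subseteq> A" "r > 0"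
  shows "avg r A B (embed A S h) s t = avg r A (B \<inter> S) (embed A S h) s t"
proof -
  have "S - B \<inter> S = S - B" "B \<inter> S \<inter> S = B \<inter> S" "B \<inter> S \<subseteq> A" using assms by auto
  then show ?thesis using assms by (simp add: avg_embed)
qed

lemma avg_embed_self:
  assumes "finite A" "S \<subseteq> A" "r > 0"
  shows "avg r A S (embed A S h) s t = embed A S h s t"
proof -
  have "merge S s (\<lambda>_. 0) = restr S s" for s by (auto simp: merge_def restr_def)
  then show ?thesis using assms by (simp add: avg_embed embed_entry cfgs_empty)
qed

lemma avg_add: "avg r A B (\<lambda>s t. X s t + Y s t) s t = avg r A B X s t + avg r A B Y s t"
  by (simp add: avg_def ptrace_def sum.distrib algebra_simps add_divide_distrib)

lemma avg_cong:
  assumes "op_eq r A X Y" "s \<in> cfgs r A" "t \<in> cfgs r A" "B \<subseteq> A"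
  shows "avg r A B X s t = avg r A B Y s t"
proof -
  have "merge B s u \<in> cfgs r A" if "u \<in> cfgs r (A - B)" "s \<in> cfgs r A" for u s
    using that assms(4) by (auto simp: merge_def cfgs_def)
  then have "ptrace r A B X s t = ptrace r A B Y s t"
    using assms unfolding ptrace_def op_eq_def by (auto intro!: sum.cong)
  then show ?thesis by (simp add: avg_def)
qed

section \<open>Moebius inversion truncated at pairs of sites\<close>

definition prs :: "nat set \<Rightarrow> (nat \<times> nat) set" where
  "prs A = {(i, j). i \<in> A \<and> j \<in> A \<and> i < j}"

lemma finite_prs: "finite A \<Longrightarrow> finite (prs A)"
  by (rule finite_subset[of _ "A \<times> A"]) (auto simp: prs_def)

text \<open>Inclusion-exclusion increments of \<open>f\<close> over sets with at most two elements.
  For \<open>f B = avg r A B H s t\<close> they are the entries of the embedded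
  \<open>Tpair\<close>, of the embedded \<open>Tsite\<close> and of the normalised trace.\<close>

definition mobius :: "(nat set \<Rightarrow> complex) \<Rightarrow> nat set \<Rightarrow> complex" where
  "mobius f A = (\<Sum>(i, j)\<in>prs A. f {i, j} - f {i} - f {j} + f {}) + (\<Sum>i\<in>A. f {i} - f {}) + f {}"

lemma mobius_add: "mobius (\<lambda>B. f B + g B) A = mobius f A + mobius g A"
  by (simp add: mobius_def sum.distrib sum_subtractf case_prod_beta algebra_simps)

lemma mobius_cong:
  assumes "\<And>B. B \<subseteq> A \<Longrightarrow> f B = g B"
  shows "mobius f A = mobius g A"
  unfolding mobius_def using assms
  by (auto intro!: arg_cong2[where f = plus] sum.cong simp: prs_def)

text \<open>An increment involving a site outside \<open>S\<close> vanishes, because adding such a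
  site does not change \<open>f\<close>. What is left is inversion over all subsets of
  \<open>S\<close>, which telescopes to \<open>f S\<close>; the bound on \<open>card S\<close> makes
  pairs sufficient.\<close>

lemma mobius_two_body:
  assumes fin: "finite A" and S: "S \<subseteq> A" "card S \<le> 2"
    and f: "\<And>B. B \<subseteq> A \<Longrightarrow> f B = f (B \<inter> S)"
  shows "mobius f A = f S"
proof -
  have finS: "finite S" using fin S finite_subset by auto
  have z1: "f {i} - f {} = 0" if "i \<in> A" "i \<notin> S" for i
    using f[of "{i}"] that by simp
  have z: "f {i, j} - f {i} - f {j} + f {} = 0" if ij: "i \<in> A" "j \<in> A" "i \<notin> S \<or> j \<notin> S" for i j
  proof (cases "i \<in> S")
    case True
    then have "{i, j} \<inter> S = {i} \<inter> S" using ij by auto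
    then have "f {i, j} = f {i}" using f[of "{i, j}"] f[of "{i}"] ij by simp
    then show ?thesis using z1[of j] ij True by simp
  next
    case False
    then have "{i, j} \<inter> S = {j} \<inter> S" by auto
    then have "f {i, j} = f {j}" using f[of "{i, j}"] f[of "{j}"] ij by simp
    then show ?thesis using z1[of i] ij False by simp
  qed
  have "(\<Sum>(i, j)\<in>prs A. f {i, j} - f {i} - f {j} + f {}) = (\<Sum>(i, j)\<in>prs S. f {i, j} - f {i} - f {j} + f {})"
    using S z by (intro sum.mono_neutral_right finite_prs fin) (fastforce simp: prs_def)+
  moreover have "(\<Sum>i\<in>A. f {i} - f {}) = (\<Sum>i\<in>S. f {i} - f {})"
    using S z1 fin by (intro sum.mono_neutral_right) auto
  moreover have "(\<Sum>(i, j)\<in>prs S. f {i, j} - f {i} - f {j} + f {}) + (\<Sum>i\<in>S. f {i} - f {}) + f {} = f S"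
  proof -
    consider "card S = 0" | "card S = 1" | "card S = 2" using S(2) by linarith
    then show ?thesis
    proof cases
      case 1
      then have "S = {}" using finS by simp
      then show ?thesis by (simp add: prs_def)
    next
      case 2
      then obtain a where a: "S = {a}" by (auto simp: card_1_singleton_iff)
      have "prs {a} = {}" by (auto simp: prs_def)
      then show ?thesis unfolding a by simp
    next
      case 3
      then obtain x y where "S = {x, y}" "x \<noteq> y" by (auto simp: card_2_iff)
      then obtain a b where ab: "S = {a, b}" "a < b"
        by (metis insert_commute linorder_neqE_nat)
      have "prs {a, b} = {(a, b)}" using ab(2) by (auto simp: prs_def)
      then show ?thesis unfolding ab(1) using ab(2) by simp
    qed
  qed
  ultimately show ?thesis by (simp add: mobius_def)
qed

text \<open>By linearity of \<open>avg\<close> and \<open>mobius\<close> a single term suffices. It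
  is local on \<open>S\<close>, so the inversion returns its average onto \<open>S\<close>, which is
  the term itself.\<close>

lemma mobius_avg_local:
  assumes "finite A" "r > 0" "\<forall>(S, h)\<in>set ts. S \<subseteq> A \<and> card S \<le> 2"
  shows "mobius (\<lambda>B. avg r A B (\<lambda>s t. \<Sum>(S, h)\<leftarrow>ts. embed A S h s t) s t) A
    = (\<Sum>(S, h)\<leftarrow>ts. embed A S h s t)"
  using assms(3)
proof (induction ts)
  case Nil
  then show ?case by (simp add: mobius_def avg_def ptrace_def)
next
  case (Cons p ts)
  obtain S h where p: "p = (S, h)" by (cases p)
  have S: "S \<subseteq> A" "card S \<le> 2" using Cons.prems p by auto
  have "mobius (\<lambda>B. avg r A B (embed A S h) s t) A = avg r A S (embed A S h) s t"
    using assms S by (intro mobius_two_body) (auto intro: avg_embed_inter)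
  then have "mobius (\<lambda>B. avg r A B (embed A S h) s t) A = embed A S h s t"
    using assms S by (simp add: avg_embed_self)
  then show ?case
    using Cons by (simp add: p avg_add mobius_add)
qed

lemma embed_Tsite:
  assumes "finite A" "i \<in> A"
  shows "embed A {i} (Tsite r A r lid X i) s t = avg r A {i} X s t - avg r A {} X s t"
proof -
  have "(\<forall>k\<in>A. s k = t k) \<longleftrightarrow> s i = t i \<and> (\<forall>k\<in>A - {i}. s k = t k)" using assms by auto
  then show ?thesis
    using assms unfolding embed_entry[OF assms(1)] Tsite_def ptrace_restr avg_def ptrace_empty
    by (auto simp: restr_def lid_def algebra_simps)
qed

lemma embed_Tpair:
  assumes "finite A" "i \<in> A" "j \<in> A" "i \<noteq> j"
  shows "embed A {i, j} (Tpair r A r lid X i j) s t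
    = avg r A {i, j} X s t - avg r A {i} X s t - avg r A {j} X s t + avg r A {} X s t"
proof -
  have 1: "(\<forall>k\<in>A. s k = t k) \<longleftrightarrow> s i = t i \<and> s j = t j \<and> (\<forall>k\<in>A - {i, j}. s k = t k)"
    "(\<forall>k\<in>A - {i}. s k = t k) \<longleftrightarrow> s j = t j \<and> (\<forall>k\<in>A - {i, j}. s k = t k)"
    "(\<forall>k\<in>A - {j}. s k = t k) \<longleftrightarrow> s i = t i \<and> (\<forall>k\<in>A - {i, j}. s k = t k)"
    using assms by auto
  have "restr {i} (restr {i, j} s) = restr {i} s" "restr {j} (restr {i, j} s) = restr {j} s" for s
    by (auto simp: restr_def)
  then have 2: "ptrace r A {i} X (restr {i, j} s) (restr {i, j} t) = ptrace r A {i} X s t"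
    "ptrace r A {j} X (restr {i, j} s) (restr {i, j} t) = ptrace r A {j} X s t"
    using ptrace_restr[of r A "{i}" X "restr {i, j} s" "restr {i, j} t"] ptrace_restr[of r A "{i}" X s t]
      ptrace_restr[of r A "{j}" X "restr {i, j} s" "restr {i, j} t"] ptrace_restr[of r A "{j}" X s t]
    by simp_all
  have 3: "card (A - {i, j}) = card A - 2" "card (A - {i}) = card A - 1" "card (A - {j}) = card A - 1"
    using assms by (auto simp: card_Diff_subset)
  show ?thesis
    unfolding embed_entry[OF assms(1)] Tpair_def ptrace_restr 2 avg_def ptrace_empty 3 Diff_empty 1
    by (auto simp: restr_def lid_def algebra_simps)
qed

text \<open>Each local term is recovered from its averages and averaging is linear, so the expansion
  can be written with averages of \<open>H\<close> alone, independent of the chosen representation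
  \<open>ts\<close>.\<close>

lemma two_local_decomposition:
  assumes A: "finite A" and r: "r > 0"
    and ts: "\<forall>(S, h)\<in>set ts. S \<subseteq> A \<and> card S \<le> 2"
    and H: "op_eq r A H (\<lambda>s t. \<Sum>(S, h)\<leftarrow>ts. embed A S h s t)"
    and st: "s \<in> cfgs r A" "t \<in> cfgs r A"
  shows "H s t = (\<Sum>(i, j)\<in>prs A. embed A {i, j} (Tpair r A r lid H i j) s t)
    + (\<Sum>i\<in>A. embed A {i} (Tsite r A r lid H i) s t)
    + mtrace r A H / of_nat r ^ card A * lpow A lid s t"
proof -
  have "H s t = (\<Sum>(S, h)\<leftarrow>ts. embed A S h s t)" using H st by (simp add: op_eq_def)
  also have "\<dots> = mobius (\<lambda>B. avg r A B (\<lambda>s t. \<Sum>(S, h)\<leftarrow>ts. embed A S h s t) s t) A"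
    using mobius_avg_local[OF A r ts] by simp
  also have "\<dots> = mobius (\<lambda>B. avg r A B H s t) A"
    using avg_cong[OF H st] by (auto intro: mobius_cong)
  also have "\<dots> = (\<Sum>(i, j)\<in>prs A. embed A {i, j} (Tpair r A r lid H i j) s t)
    + (\<Sum>i\<in>A. embed A {i} (Tsite r A r lid H i) s t) + avg r A {} H s t"
    unfolding mobius_def using A
    by (auto intro!: arg_cong2[where f = plus] sum.cong simp: prs_def embed_Tsite embed_Tpair)
  finally show ?thesis using A by (simp add: avg_def ptrace_empty lpow_lid)
qed

section \<open>The generator on a product state\<close>

lemma lmult_lid: "a < d \<Longrightarrow> lmult d lid X a b = X a b" "b < d \<Longrightarrow> lmult d X lid a b = X a b"
  by (simp_all add: lmult_def lid_def if_distrib[of "\<lambda>x. _ * x"] if_distrib[of "\<lambda>x. x * _"] cong: if_cong)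

lemma ladj_lid: "ladj lid = lid"
  by (auto simp: ladj_def lid_def fun_eq_iff)

text \<open>On the complement of \<open>S\<close> one factor is the identity, so both orders of
  multiplication leave \<open>lpow (A - S) e\<close> as a common factor.\<close>

lemma mcomm_embed:
  assumes "finite A" "S \<subseteq> A" "s \<in> cfgs d A" "t \<in> cfgs d A"
  shows "mcomm d A (embed A S h) (lpow A e) s t
    = mtensor S (mcomm d S h (lpow S e)) (A - S) (lpow (A - S) e) s t"
proof -
  let ?T = "A - S"
  have A: "A = S \<union> ?T" "S \<inter> ?T = {}" "finite S" "finite ?T" using assms finite_subset by auto
  have e: "lpow A e = mtensor S (lpow S e) ?T (lpow ?T e)"
    by (subst A(1)) (rule lpow_mtensor[OF A(2-4)])
  have m: "mmult d A (mtensor S X ?T Y) (mtensor S X' ?T Y') = mtensor S (mmult d S X X') ?T (mmult d ?T Y Y')" for X Y X' Y'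
    by (subst A(1)) (rule mmult_mtensor[OF A(2)])
  have st: "restr ?T s \<in> cfgs d ?T" "restr ?T t \<in> cfgs d ?T" using assms restr_cfgs by auto
  show ?thesis
    unfolding mcomm_def embed_def e m
    by (simp add: mtensor_def mmult_lid_left mmult_lid_right st A(4) algebra_simps)
qed

lemma dissip_embed:
  assumes "finite A" "S \<subseteq> A" "s \<in> cfgs d A" "t \<in> cfgs d A"
  shows "dissip d A (embed A S h) (lpow A e) s t
    = mtensor S (dissip d S h (lpow S e)) (A - S) (lpow (A - S) e) s t"
proof -
  let ?T = "A - S"
  have A: "A = S \<union> ?T" "S \<inter> ?T = {}" "finite S" "finite ?T" using assms finite_subset by auto
  have e: "lpow A e = mtensor S (lpow S e) ?T (lpow ?T e)"
    by (subst A(1)) (rule lpow_mtensor[OF A(2-4)])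
  have m: "mmult d A (mtensor S X ?T Y) (mtensor S X' ?T Y') = mtensor S (mmult d S X X') ?T (mmult d ?T Y Y')" for X Y X' Y'
    by (subst A(1)) (rule mmult_mtensor[OF A(2)])
  have st: "restr ?T s \<in> cfgs d ?T" "restr ?T t \<in> cfgs d ?T" using assms restr_cfgs by auto
  have l: "madj (lpow ?T lid) = lpow ?T lid" by (simp add: madj_lpow ladj_lid)
  \<comment> \<open>Reassociation places every identity factor at an outer index, where the
    configurations are known to lie in \<open>cfgs d ?T\<close> and the unit laws apply.\<close>
  have "mmult d ?T (mmult d ?T (lpow ?T lid) (lpow ?T lid)) (lpow ?T e) = mmult d ?T (lpow ?T lid) (mmult d ?T (lpow ?T lid) (lpow ?T e))"
    by (rule mmult_assoc)
  moreover have "mmult d ?T (lpow ?T e) (mmult d ?T (lpow ?T lid) (lpow ?T lid)) = mmult d ?T (mmult d ?T (lpow ?T e) (lpow ?T lid)) (lpow ?T lid)"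
    by (rule mmult_assoc[symmetric])
  ultimately show ?thesis
    unfolding dissip_def embed_def e m madj_mtensor l
    by (simp add: mtensor_def mmult_lid_left mmult_lid_right st A(4) algebra_simps)
qed

lemma mcomm_lin:
  "mcomm d A (\<lambda>s t. X s t + Y s t) Z s t = mcomm d A X Z s t + mcomm d A Y Z s t"
  "mcomm d A (\<lambda>s t. c * X s t) Z s t = c * mcomm d A X Z s t"
  "mcomm d A (\<lambda>s t. \<Sum>m\<in>M. F m s t) Z s t = (\<Sum>m\<in>M. mcomm d A (F m) Z s t)"
  by (auto simp: mcomm_def mmult_def algebra_simps sum.distrib sum_subtractf sum_distrib_left
      sum.swap[of _ M])

text \<open>Each local term changes the product state only on its own sites. Grouping by sites
  collects \<open>Tsite\<close> with the Lindblad operators of that site and leaves the pair parts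
  as pure commutators.\<close>

lemma lindbladian_decomposition:
  assumes A: "finite A" and r: "r > 0"
    and ts: "\<forall>(S, h)\<in>set ts. S \<subseteq> A \<and> card S \<le> 2"
    and H: "op_eq r A H (\<lambda>s t. \<Sum>(S, h)\<leftarrow>ts. embed A S h s t)"
    and st: "s \<in> cfgs r A" "t \<in> cfgs r A"
  shows "lindbladian r A H Gam L (lpow A e) s t =
     (\<Sum>i\<in>A. mtensor {i} (\<lambda>s t. - \<i> * mcomm r {i} (Tsite r A r lid H i) (lpow {i} e) s t
             + (\<Sum>\<alpha>\<in>Gam i. dissip r {i} (lpow {i} (L i \<alpha>)) (lpow {i} e) s t))
        (A - {i}) (lpow (A - {i}) e) s t)
   + (\<Sum>(i, j)\<in>prs A. mtensor {i, j} (\<lambda>s t. - \<i> * mcomm r {i, j} (Tpair r A r lid H i j) (lpow {i, j} e) s t)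
        (A - {i, j}) (lpow (A - {i, j}) e) s t)"
proof -
  let ?R = "lpow A e"
  have "op_eq r A (mcomm r A H ?R) (mcomm r A (\<lambda>s t. (\<Sum>p\<in>prs A. embed A {fst p, snd p} (Tpair r A r lid H (fst p) (snd p)) s t)
    + (\<Sum>i\<in>A. embed A {i} (Tsite r A r lid H i) s t)
    + mtrace r A H / of_nat r ^ card A * lpow A lid s t) ?R)"
    using two_local_decomposition[OF A r ts H]
    by (intro mcomm_cong) (auto simp: op_eq_def case_prod_beta)
  then have "mcomm r A H ?R s t = (\<Sum>p\<in>prs A. mcomm r A (embed A {fst p, snd p} (Tpair r A r lid H (fst p) (snd p))) ?R s t)
    + (\<Sum>i\<in>A. mcomm r A (embed A {i} (Tsite r A r lid H i)) ?R s t)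
    + mtrace r A H / of_nat r ^ card A * mcomm r A (lpow A lid) ?R s t"
    using st unfolding mcomm_lin by (simp add: op_eq_def)
  \<comment> \<open>The scalar part of \<open>H\<close> commutes with everything.\<close>
  also have "mcomm r A (lpow A lid) ?R s t = 0"
    using A st by (simp add: mcomm_def mmult_lid_left mmult_lid_right)
  also have "(\<Sum>p\<in>prs A. mcomm r A (embed A {fst p, snd p} (Tpair r A r lid H (fst p) (snd p))) ?R s t)
    = (\<Sum>(i, j)\<in>prs A. mtensor {i, j} (mcomm r {i, j} (Tpair r A r lid H i j) (lpow {i, j} e)) (A - {i, j}) (lpow (A - {i, j}) e) s t)"
    unfolding case_prod_beta using st
    by (intro sum.cong refl mcomm_embed[OF A]) (auto simp: prs_def)
  also have "(\<Sum>i\<in>A. mcomm r A (embed A {i} (Tsite r A r lid H i)) ?R s t)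
    = (\<Sum>i\<in>A. mtensor {i} (mcomm r {i} (Tsite r A r lid H i) (lpow {i} e)) (A - {i}) (lpow (A - {i}) e) s t)"
    using st by (intro sum.cong refl mcomm_embed[OF A]) auto
  finally have c: "mcomm r A H ?R s t = (\<Sum>(i, j)\<in>prs A. mtensor {i, j} (mcomm r {i, j} (Tpair r A r lid H i j) (lpow {i, j} e)) (A - {i, j}) (lpow (A - {i, j}) e) s t)
    + (\<Sum>i\<in>A. mtensor {i} (mcomm r {i} (Tsite r A r lid H i) (lpow {i} e)) (A - {i}) (lpow (A - {i}) e) s t)"
    by simp
  have d: "(\<Sum>i\<in>A. \<Sum>\<alpha>\<in>Gam i. dissip r A (at_site A i (L i \<alpha>)) ?R s t)
    = (\<Sum>i\<in>A. \<Sum>\<alpha>\<in>Gam i. mtensor {i} (dissip r {i} (lpow {i} (L i \<alpha>)) (lpow {i} e)) (A - {i}) (lpow (A - {i}) e) s t)"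
    unfolding at_site_def using st by (intro sum.cong refl dissip_embed[OF A]) auto
  show ?thesis
    unfolding lindbladian_def c d
    by (simp add: mtensor_def sum_distrib_left sum_distrib_right sum.distrib sum_subtractf algebra_simps case_prod_beta sum_negf)
qed

section \<open>The faithful diagonal case\<close>

definition ldiag :: "(nat \<Rightarrow> complex) \<Rightarrow> lop" where
  "ldiag \<mu> = (\<lambda>a b. if a = b then \<mu> a else 0)"

lemma lpow_ldiag:
  assumes "finite A"
  shows "lpow A (ldiag \<mu>) s t = of_bool (\<forall>i\<in>A. s i = t i) * (\<Prod>i\<in>A. \<mu> (s i))"
proof (cases "\<forall>i\<in>A. s i = t i")
  case True
  then show ?thesis by (auto simp: lpow_def ldiag_def intro: prod.cong)
next
  case False
  then have "(\<Prod>i\<in>A. ldiag \<mu> (s i) (t i)) = 0"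
    using assms by (auto simp: ldiag_def)
  then show ?thesis using False by (auto simp: lpow_def)
qed

lemma lpow_ldiag_cfgs:
  assumes "finite A" "s \<in> cfgs d A" "t \<in> cfgs d' A"
  shows "lpow A (ldiag \<mu>) s t = (if s = t then \<Prod>i\<in>A. \<mu> (s i) else 0)"
  using lpow_ldiag[OF assms(1)] cfgs_eq_iff[OF assms(2,3)] by auto

lemma mmult_diag_right:
  assumes "finite A" "t \<in> cfgs d A" "\<And>u. u \<in> cfgs d A \<Longrightarrow> R u t = (if u = t then D t else 0)"
  shows "mmult d A X R s t = X s t * D t"
proof -
  have "mmult d A X R s t = (\<Sum>u\<in>cfgs d A. if u = t then X s t * D t else 0)"
    unfolding mmult_def using assms by (intro sum.cong) auto
  then show ?thesis using assms finite_cfgs by (simp add: sum.delta')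
qed

lemma mmult_diag_left:
  assumes "finite A" "s \<in> cfgs d A" "\<And>u. u \<in> cfgs d A \<Longrightarrow> R s u = (if s = u then D s else 0)"
  shows "mmult d A R X s t = D s * X s t"
proof -
  have "mmult d A R X s t = (\<Sum>u\<in>cfgs d A. if s = u then D s * X s t else 0)"
    unfolding mmult_def using assms by (intro sum.cong) auto
  then show ?thesis using assms finite_cfgs by (simp add: sum.delta)
qed

lemma mcomm_diag:
  assumes "finite A" "s \<in> cfgs d A" "t \<in> cfgs d A"
    "\<And>u v. u \<in> cfgs d A \<Longrightarrow> v \<in> cfgs d A \<Longrightarrow> R u v = (if u = v then D u else 0)"
  shows "mcomm d A X R s t = X s t * (D t - D s)"
  unfolding mcomm_def using assms
  by (subst mmult_diag_right[where D = D], simp, simp, simp)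
    (subst mmult_diag_left[where D = D], auto simp: algebra_simps)

text \<open>\<open>prs\<close> lists each pair once, smaller site first. Symmetry of
  \<open>f\<close> allows a pair through \<open>i\<close> to be written with \<open>i\<close> in
  front, on whichever side of \<open>i\<close> the other site lies.\<close>

lemma sum_prs_through:
  fixes f :: "nat \<Rightarrow> nat \<Rightarrow> complex"
  assumes "finite A" "i \<in> A"
    and sym: "\<And>p q. p \<in> A \<Longrightarrow> q \<in> A \<Longrightarrow> p \<noteq> q \<Longrightarrow> f q p = f p q"
    and z: "\<And>p q. (p, q) \<in> prs A \<Longrightarrow> p \<noteq> i \<Longrightarrow> q \<noteq> i \<Longrightarrow> f p q = 0"
  shows "(\<Sum>(p, q)\<in>prs A. f p q) = (\<Sum>j\<in>A - {i}. f i j)"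
proof -
  have "(\<Sum>(p, q)\<in>prs A. f p q) = (\<Sum>(p, q)\<in>{x \<in> prs A. fst x = i \<or> snd x = i}. f p q)"
    using assms(1) by (intro sum.mono_neutral_right finite_prs) (auto intro: z)
  also have "\<dots> = (\<Sum>j\<in>A - {i}. f i j)"
    by (rule sum.reindex_bij_witness[where i = "\<lambda>j. (min i j, max i j)" and j = "\<lambda>(p, q). if p = i then q else p"])
      (use assms in \<open>auto simp: prs_def min_def max_def\<close>)
  finally show ?thesis .
qed

text \<open>Changing a single coordinate shows that each summand is constant, and the weighted mean
  condition makes the constant vanish.\<close>

lemma separable_sum_zero:
  fixes h :: "nat \<Rightarrow> nat \<Rightarrow> complex" and w :: "nat \<Rightarrow> complex"
  assumes fin: "finite J" and r: "r > 0"
    and h: "\<And>u. u \<in> cfgs r J \<Longrightarrow> (\<Sum>j\<in>J. h j (u j)) = G"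
    and m: "\<And>j. j \<in> J \<Longrightarrow> (\<Sum>c<r. w c * h j c) = 0" and w: "(\<Sum>c<r. w c) \<noteq> 0"
  shows "G = 0" and "\<And>j c. j \<in> J \<Longrightarrow> c < r \<Longrightarrow> h j c = 0"
proof -
  have z: "(\<lambda>_. 0) \<in> cfgs r J" using r by (auto simp: cfgs_def)
  have c: "h j c = h j 0" if "j \<in> J" "c < r" for j c
  proof -
    have u: "(\<lambda>_. 0)(j := c) \<in> cfgs r J" using r that by (auto simp: cfgs_def)
    have "(\<Sum>k\<in>J. h k (((\<lambda>_. 0)(j := c)) k)) = h j c + (\<Sum>k\<in>J - {j}. h k 0)"
      using fin that by (subst sum.remove[of _ j]) (auto intro!: sum.cong)
    moreover have "(\<Sum>k\<in>J. h k 0) = h j 0 + (\<Sum>k\<in>J - {j}. h k 0)"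
      using fin that by (subst sum.remove[of _ j]) auto
    ultimately show ?thesis using h[OF u] h[OF z] by simp
  qed
  show h0: "h j c = 0" if j: "j \<in> J" "c < r" for j c
  proof -
    have "(\<Sum>c<r. w c) * h j 0 = (\<Sum>c<r. w c * h j c)"
      unfolding sum_distrib_right by (intro sum.cong refl) (metis c j(1) lessThan_iff)
    then have "h j 0 = 0" using m[OF j(1)] w by simp
    then show ?thesis using c[OF j] by simp
  qed
  show "G = 0" using h[OF z] h0 r by simp
qed

text \<open>\<open>\<tau> i j a b c d\<close> stands for the entry of a pair operator in row
  \<open>(a, b)\<close> and column \<open>(c, d)\<close>; the bracket in \<open>\<mu>\<close> comes
  from the commutator with a diagonal state. \<open>tr\<close> says that the partial trace over the
  second site is zero, \<open>gtr\<close> that each \<open>g i\<close> is traceless.\<close>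

lemma local_terms_vanish:
  fixes g :: "nat \<Rightarrow> lop" and \<tau> :: "nat \<Rightarrow> nat \<Rightarrow> nat \<Rightarrow> nat \<Rightarrow> nat \<Rightarrow> nat \<Rightarrow> complex"
  assumes fin: "finite A" and r: "r > 0"
    and mu: "\<And>k. k < r \<Longrightarrow> \<mu> k \<noteq> 0" and mu1: "(\<Sum>k<r. \<mu> k) \<noteq> 0"
    and sym: "\<And>i j a b c d. i \<noteq> j \<Longrightarrow> \<tau> j i b a d c = \<tau> i j a b c d"
    and tr: "\<And>i j a b. i \<in> A \<Longrightarrow> j \<in> A \<Longrightarrow> i \<noteq> j \<Longrightarrow> a < r \<Longrightarrow> b < r \<Longrightarrow> (\<Sum>c<r. \<tau> i j a c b c) = 0"
    and gtr: "\<And>i. i \<in> A \<Longrightarrow> (\<Sum>c<r. g i c c) = 0"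
    and K: "\<And>s t. s \<in> cfgs r A \<Longrightarrow> t \<in> cfgs r A \<Longrightarrow>
      (\<Sum>i\<in>A. g i (s i) (t i) * lpow (A - {i}) (ldiag \<mu>) s t)
      + (\<Sum>(i, j)\<in>prs A. \<tau> i j (s i) (s j) (t i) (t j) * (\<mu> (t i) * \<mu> (t j) - \<mu> (s i) * \<mu> (s j))
           * lpow (A - {i, j}) (ldiag \<mu>) s t) = 0"
  shows "\<And>i a b. i \<in> A \<Longrightarrow> a < r \<Longrightarrow> b < r \<Longrightarrow> g i a b = 0"
    and "\<And>i j a b c d. i \<in> A \<Longrightarrow> j \<in> A \<Longrightarrow> i \<noteq> j \<Longrightarrow> a < r \<Longrightarrow> b < r \<Longrightarrow> c < r \<Longrightarrow> d < r \<Longrightarrow>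
      \<tau> i j a b c d * (\<mu> c * \<mu> d - \<mu> a * \<mu> b) = 0"
proof -
  let ?\<Delta> = "\<lambda>B s t. lpow B (ldiag \<mu>) s t"
  let ?f = "\<lambda>s t i j. \<tau> i j (s i) (s j) (t i) (t j) * (\<mu> (t i) * \<mu> (t j) - \<mu> (s i) * \<mu> (s j)) * ?\<Delta> (A - {i, j}) s t"
  have fsym: "?f s t q p = ?f s t p q" if "p \<noteq> q" for s t p q
    using sym[OF that] by (simp add: insert_commute mult.commute)
  have nz: "(\<Prod>i\<in>B. \<mu> (u i)) \<noteq> 0" if "B \<subseteq> A" "\<And>i. i \<in> B \<Longrightarrow> u i < r" for B u
    using that mu finite_subset[OF that(1) fin] by (auto simp: prod_zero_iff)
  \<comment> \<open>Here \<open>s = t\<close>, so every pair term carries the factor zero. After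
    division by the product of all \<open>\<mu> (u i)\<close> the sum is separable, and with weights
    \<open>\<mu>\<close> the mean condition is \<open>gtr\<close>.\<close>
  have diag: "g i c c = 0" if i: "i \<in> A" "c < r" for i c
  proof -
    have "(\<Sum>j\<in>A. g j (u j) (u j) / \<mu> (u j)) = 0" if u: "u \<in> cfgs r A" for u
    proof -
      have lt: "u i < r" if "i \<in> A" for i using u that by (auto simp: cfgs_def)
      have "(\<Sum>j\<in>A. g j (u j) (u j) * ?\<Delta> (A - {j}) u u) = 0"
        using K[OF u u] by (simp add: case_prod_beta)
      moreover have "g j (u j) (u j) * ?\<Delta> (A - {j}) u u = (\<Prod>i\<in>A. \<mu> (u i)) * (g j (u j) (u j) / \<mu> (u j))"
        if "j \<in> A" for j
        using that mu[OF lt[OF that]] fin by (simp add: lpow_ldiag prod.remove[of A j])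
      ultimately have "(\<Prod>i\<in>A. \<mu> (u i)) * (\<Sum>j\<in>A. g j (u j) (u j) / \<mu> (u j)) = 0"
        by (simp add: sum_distrib_left)
      then show ?thesis using nz[of A u] lt by simp
    qed
    moreover have "(\<Sum>c<r. \<mu> c * (g j c c / \<mu> c)) = 0" if "j \<in> A" for j
      using gtr[OF that] mu by simp
    ultimately have "g i c c / \<mu> c = 0"
      using separable_sum_zero(2)[OF fin r, of "\<lambda>j c. g j c c / \<mu> c" 0 \<mu> i c] mu1 i by simp
    then show ?thesis using mu[OF i(2)] by simp
  qed
  \<comment> \<open>Here \<open>s\<close> and \<open>t\<close> differ exactly at \<open>i\<close>.
    Only \<open>g i\<close> and the pairs through \<open>i\<close> survive; the factor
    \<open>\<mu> (u j)\<close> left by the commutator completes the common product over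
    \<open>A - {i}\<close>, and constant weights turn \<open>tr\<close> into the mean
    condition.\<close>
  have off: "g i a b = 0 \<and> (\<forall>j\<in>A - {i}. \<forall>c<r. (\<mu> b - \<mu> a) * \<tau> i j a c b c = 0)"
    if i: "i \<in> A" "a < r" "b < r" "a \<noteq> b" for i a b
  proof -
    have S: "(\<Sum>j\<in>A - {i}. (\<mu> b - \<mu> a) * \<tau> i j a (u j) b (u j)) = - g i a b" if u: "u \<in> cfgs r (A - {i})" for u
    proof -
      define s where "s = u(i := a)"
      define t where "t = u(i := b)"
      have st: "s \<in> cfgs r A" "t \<in> cfgs r A"
        using u i by (auto simp: s_def t_def cfgs_def)
      have lt: "u k < r" if "k \<in> A - {i}" for k using u that by (auto simp: cfgs_def)
      have d0: "?\<Delta> B s t = 0" if "B \<subseteq> A" "i \<in> B" for B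
        using that fin finite_subset i by (subst lpow_ldiag) (auto simp: s_def t_def)
      have d1: "?\<Delta> B s t = (\<Prod>k\<in>B. \<mu> (u k))" if "B \<subseteq> A" "i \<notin> B" for B
      proof -
        have "finite B" using that fin finite_subset by auto
        moreover have "\<forall>k\<in>B. s k = u k" "\<forall>k\<in>B. t k = u k" using that by (auto simp: s_def t_def)
        ultimately show ?thesis by (simp add: lpow_ldiag)
      qed
      have f1: "(\<Sum>k\<in>A. g k (s k) (t k) * ?\<Delta> (A - {k}) s t) = g i a b * (\<Prod>k\<in>A - {i}. \<mu> (u k))"
      proof -
        have "(\<Sum>k\<in>A - {i}. g k (s k) (t k) * ?\<Delta> (A - {k}) s t) = 0"
          using i by (intro sum.neutral) (auto simp: d0)
        then show ?thesis using fin i by (simp add: sum.remove[of A i] d1) (simp add: s_def t_def)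
      qed
      have f2: "(\<Sum>(p, q)\<in>prs A. ?f s t p q) = (\<Sum>j\<in>A - {i}. ?f s t i j)"
        using i by (intro sum_prs_through[OF fin i(1)] fsym) (auto simp: d0)
      have "?f s t i j = (\<Prod>k\<in>A - {i}. \<mu> (u k)) * ((\<mu> b - \<mu> a) * \<tau> i j a (u j) b (u j))"
        if j: "j \<in> A - {i}" for j
      proof -
        have "A - {i} - {j} = A - {i, j}" by auto
        then have "(\<Prod>k\<in>A - {i}. \<mu> (u k)) = \<mu> (u j) * (\<Prod>k\<in>A - {i, j}. \<mu> (u k))"
          using prod.remove[of "A - {i}" j "\<lambda>k. \<mu> (u k)"] fin j by simp
        moreover have "s i = a" "t i = b" "s j = u j" "t j = u j" using j by (auto simp: s_def t_def)
        ultimately show ?thesis by (simp add: d1 algebra_simps)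
      qed
      then have f3: "(\<Sum>j\<in>A - {i}. ?f s t i j)
        = (\<Prod>k\<in>A - {i}. \<mu> (u k)) * (\<Sum>j\<in>A - {i}. (\<mu> b - \<mu> a) * \<tau> i j a (u j) b (u j))"
        unfolding sum_distrib_left by (intro sum.cong refl)
      have "(\<Prod>k\<in>A - {i}. \<mu> (u k)) * (g i a b + (\<Sum>j\<in>A - {i}. (\<mu> b - \<mu> a) * \<tau> i j a (u j) b (u j))) = 0"
        using K[OF st] unfolding f1 f2 f3 distrib_left by (simp only: mult.commute)
      then have "g i a b + (\<Sum>j\<in>A - {i}. (\<mu> b - \<mu> a) * \<tau> i j a (u j) b (u j)) = 0"
        using nz[of "A - {i}" u] lt by auto
      then show ?thesis by (simp add: add_eq_0_iff)
    qed
    have M: "(\<Sum>c<r. 1 * ((\<mu> b - \<mu> a) * \<tau> i j a c b c)) = 0" if "j \<in> A - {i}" for j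
      using tr[of i j a b] that i by (simp add: sum_distrib_left[symmetric])
    have W: "(\<Sum>c<r. (1::complex)) \<noteq> 0" using r by simp
    have "finite (A - {i})" using fin by simp
    note * = separable_sum_zero[OF this r, of "\<lambda>j c. (\<mu> b - \<mu> a) * \<tau> i j a c b c" "- g i a b" "\<lambda>_. 1", OF S M W]
    show ?thesis using *(1) *(2) by auto
  qed
  show "g i a b = 0" if "i \<in> A" "a < r" "b < r" for i a b
    using diag[of i a] off[of i a b] that by (cases "a = b") auto
  \<comment> \<open>Now \<open>s\<close> and \<open>t\<close> differ at \<open>i\<close> and
    \<open>j\<close> and are 0 elsewhere. Every term but that of \<open>(i, j)\<close> keeps one of
    these sites in its diagonal factor and vanishes; the surviving factor is a power of
    \<open>\<mu> 0\<close>, which is nonzero.\<close>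
  have both: "\<tau> i j a b c d * (\<mu> c * \<mu> d - \<mu> a * \<mu> b) = 0"
    if ij: "i \<in> A" "j \<in> A" "i < j" "a < r" "b < r" "c < r" "d < r" and ne: "a \<noteq> c" "b \<noteq> d" for i j a b c d
  proof -
    define s where "s = ((\<lambda>_. 0)(i := a, j := b) :: cfg)"
    define t where "t = ((\<lambda>_. 0)(i := c, j := d) :: cfg)"
    have st: "s \<in> cfgs r A" "t \<in> cfgs r A"
      using ij r by (auto simp: s_def t_def cfgs_def)
    have v: "s i = a" "s j = b" "t i = c" "t j = d" using ij by (auto simp: s_def t_def)
    have d0: "?\<Delta> B s t = 0" if "B \<subseteq> A" "i \<in> B \<or> j \<in> B" for B
    proof -
      have "\<not> (\<forall>k\<in>B. s k = t k)" using that ne v by metis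
      then show ?thesis using finite_subset[OF that(1) fin] by (simp add: lpow_ldiag)
    qed
    have "(\<Sum>k\<in>A. g k (s k) (t k) * ?\<Delta> (A - {k}) s t) = 0"
      using ij by (intro sum.neutral) (auto simp: d0)
    moreover have "?\<Delta> (A - {p, q}) s t = 0" if "(p, q) \<in> prs A" "(p, q) \<noteq> (i, j)" for p q
      using that ij by (intro d0) (auto simp: prs_def)
    then have "\<forall>x\<in>prs A - {(i, j)}. (case x of (p, q) \<Rightarrow> ?f s t p q) = 0"
      unfolding Ball_def split_paired_all by auto
    then have "(\<Sum>(p, q)\<in>prs A. ?f s t p q) = (\<Sum>(p, q)\<in>{(i, j)}. ?f s t p q)"
      using ij by (intro sum.mono_neutral_right finite_prs fin) (simp_all add: prs_def)
    moreover have "?\<Delta> (A - {i, j}) s t = (\<Prod>k\<in>A - {i, j}. \<mu> 0)"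
      using fin by (simp add: lpow_ldiag) (auto simp: s_def t_def)
    ultimately show ?thesis using K[OF st] mu[OF r] fin by (simp add: v)
  qed
  show "\<tau> i j a b c d * (\<mu> c * \<mu> d - \<mu> a * \<mu> b) = 0"
    if ij: "i \<in> A" "j \<in> A" "i \<noteq> j" and lt: "a < r" "b < r" "c < r" "d < r" for i j a b c d
  proof -
    consider "a = c" "b = d" | "a \<noteq> c" "b = d" | "a = c" "b \<noteq> d" | "a \<noteq> c" "b \<noteq> d" "i < j" | "a \<noteq> c" "b \<noteq> d" "j < i"
      using ij by linarith
    then show ?thesis
    proof cases
      \<comment> \<open>The common second index lets \<open>\<mu> b\<close> be factored out of the
        bracket, which leaves the expression treated in \<open>off\<close>.\<close>
      case 2
      then have "(\<mu> c - \<mu> a) * \<tau> i j a b c b = 0" using off[of i a c] ij lt by auto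
      then show ?thesis using 2 by (auto simp: algebra_simps)
    next
      case 3
      then have "(\<mu> d - \<mu> b) * \<tau> j i b a d a = 0" using off[of j b d] ij lt by auto
      then show ?thesis using 3 sym[of i j b a d a] ij by (auto simp: algebra_simps)
    next
      case 4
      then show ?thesis using both ij lt by blast
    next
      case 5
      then have "\<tau> j i b a d c * (\<mu> d * \<mu> c - \<mu> b * \<mu> a) = 0" using both ij lt by blast
      then show ?thesis using sym[of i j b a d c] ij by (simp add: mult.commute)
    qed simp
  qed
qed

section \<open>Trace identities\<close>

lemma mtrace_mmult_commute: "mtrace d A (mmult d A X Y) = mtrace d A (mmult d A Y X)"
  unfolding mtrace_def mmult_def by (subst sum.swap) (simp add: mult.commute)

lemma mtrace_mcomm: "mtrace d A (mcomm d A X Y) = 0"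
  using mtrace_mmult_commute[of d A X Y] by (simp add: mtrace_def mcomm_def sum_subtractf)

lemma mtrace_dissip: "mtrace d A (dissip d A X Y) = 0"
proof -
  have "mtrace d A (mmult d A (mmult d A X Y) (madj X)) = mtrace d A (mmult d A (mmult d A (madj X) X) Y)"
    using mtrace_mmult_commute[of d A "mmult d A X Y" "madj X"] by (simp add: mmult_assoc)
  moreover have "mtrace d A (mmult d A Y (mmult d A (madj X) X)) = mtrace d A (mmult d A (mmult d A (madj X) X) Y)"
    by (rule mtrace_mmult_commute)
  ultimately show ?thesis
    by (simp add: mtrace_def dissip_def sum_subtractf sum.distrib sum_divide_distrib[symmetric])
qed

lemma Tpair_commute: "Tpair d A c e X j i = Tpair d A c e X i j"
  by (intro ext) (simp add: Tpair_def insert_commute algebra_simps)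

lemma restr_singleton: "restr {i} s = (\<lambda>_. 0)(i := s i)"
  by (auto simp: restr_def)

lemma restr_pair: "restr {i, j} s = (\<lambda>_. 0)(i := s i, j := s j)"
  by (auto simp: restr_def)

text \<open>Tracing out \<open>j\<close> sends the pair trace to the trace at \<open>i\<close> and
  the trace at \<open>j\<close> to the full trace, while an identity at \<open>j\<close> contributes
  \<open>r\<close>. The four terms then cancel in two pairs.\<close>

lemma Tpair_partial_trace:
  assumes A: "finite A" "i \<in> A" "j \<in> A" "i \<noteq> j" and r: "r > 0"
  shows "(\<Sum>c<r. Tpair r A r lid X i j ((\<lambda>_. 0)(i := a, j := c)) ((\<lambda>_. 0)(i := b, j := c))) = 0"
proof -
  let ?p = "\<lambda>a c. (\<lambda>_. 0::nat)(i := a, j := c)"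
  have "card A \<ge> 2" using A card_mono[of A "{i, j}"] by auto
  \<comment> \<open>Writing \<open>card A\<close> as \<open>n + 2\<close> removes truncated
    subtraction from the exponents.\<close>
  then obtain n where n: "card A = n + 2" by (metis add.commute le_Suc_ex)
  have d: "A - {i} - {j} = A - {i, j}" by auto
  have 1: "(\<Sum>c<r. ptrace r A {i, j} X (?p a c) (?p b c)) = ptrace r A {i} X ((\<lambda>_. 0)(i := a)) ((\<lambda>_. 0)(i := b))"
  proof -
    have m: "merge {i, j} (?p a c) u = merge {i} ((\<lambda>_. 0)(i := a)) (merge {j} ((\<lambda>_. 0)(j := c)) u)" for a c u
      using A by (auto simp: merge_def restr_def)
    show ?thesis
      unfolding ptrace_def m using A
      by (subst sum_cfgs_split[of "{j}" "A - {i}"], simp) (simp only: sum_cfgs_singleton d)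
  qed
  have 2: "(\<Sum>c<r. ptrace r A {j} X (restr {j} (?p a c)) (restr {j} (?p b c))) = mtrace r A X"
  proof -
    have m: "merge {j} (restr {j} (?p a c)) u = merge {j} ((\<lambda>_. 0)(j := c)) u" for a c u
      by (auto simp: merge_def restr_def)
    show ?thesis
      unfolding ptrace_def mtrace_def m using A
      by (subst sum_cfgs_split[of "{j}" A], simp) (simp only: sum_cfgs_singleton)
  qed
  have 3: "restr {i} (?p a c) = (\<lambda>_. 0)(i := a)" "?p a c i = a" "?p a c j = c" for a c
    using A by (auto simp: restr_def)
  have "(\<Sum>c<r. Tpair r A r lid X i j (?p a c) (?p b c))
    = (\<Sum>c<r. ptrace r A {i, j} X (?p a c) (?p b c)) / of_nat r ^ n
      - of_nat r * (ptrace r A {i} X ((\<lambda>_. 0)(i := a)) ((\<lambda>_. 0)(i := b)) / of_nat r ^ (n + 1))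
      - lid a b * (\<Sum>c<r. ptrace r A {j} X (restr {j} (?p a c)) (restr {j} (?p b c))) / of_nat r ^ (n + 1)
      + of_nat r * (mtrace r A X / of_nat r ^ (n + 2) * lid a b)"
    unfolding Tpair_def 3 n
    by (simp add: sum.distrib sum_subtractf sum_divide_distrib sum_distrib_left lid_def)
  also have "\<dots> = 0" unfolding 1 2 using r by (simp add: field_simps)
  finally show ?thesis .
qed

text \<open>Sufficiency is immediate from \<open>lindbladian_decomposition\<close>. For necessity
  \<open>local_terms_vanish\<close> applies: \<open>G i\<close> is traceless since commutators and
  dissipators are, and \<open>Tpair_partial_trace\<close> treats the pair part.\<close>

lemma lindbladian_faithful_iff:
  fixes A :: "nat set" and Gam :: "nat \<Rightarrow> 'a set" and \<mu> :: "nat \<Rightarrow> complex"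
  assumes A: "finite A" and r: "r > 0"
    and mu: "\<And>k. k < r \<Longrightarrow> \<mu> k \<noteq> 0" "(\<Sum>k<r. \<mu> k) \<noteq> 0"
    and ts: "\<forall>(S, h)\<in>set ts. S \<subseteq> A \<and> card S \<le> 2"
    and H: "op_eq r A H (\<lambda>s t. \<Sum>(S, h)\<leftarrow>ts. embed A S h s t)"
  shows "op_eq r A (lindbladian r A H Gam L (lpow A (ldiag \<mu>))) (\<lambda>_ _. 0) \<longleftrightarrow>
      (\<forall>i\<in>A. op_eq r {i} (\<lambda>s t. - \<i> * mcomm r {i} (Tsite r A r lid H i) (lpow {i} (ldiag \<mu>)) s t
             + (\<Sum>\<alpha>\<in>Gam i. dissip r {i} (lpow {i} (L i \<alpha>)) (lpow {i} (ldiag \<mu>)) s t)) (\<lambda>_ _. 0))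
    \<and> (\<forall>i\<in>A. \<forall>j\<in>A. i < j \<longrightarrow> op_eq r {i, j}
          (mcomm r {i, j} (Tpair r A r lid H i j) (lpow {i, j} (ldiag \<mu>))) (\<lambda>_ _. 0))"
    (is "?L \<longleftrightarrow> ?S \<and> ?P")
proof -
  define G where "G i = (\<lambda>s t. - \<i> * mcomm r {i} (Tsite r A r lid H i) (lpow {i} (ldiag \<mu>)) s t
             + (\<Sum>\<alpha>\<in>Gam i. dissip r {i} (lpow {i} (L i \<alpha>)) (lpow {i} (ldiag \<mu>)) s t))" for i
  let ?F = "\<lambda>i j. mcomm r {i, j} (Tpair r A r lid H i j) (lpow {i, j} (ldiag \<mu>))"
  have dec: "lindbladian r A H Gam L (lpow A (ldiag \<mu>)) s t =
     (\<Sum>i\<in>A. G i (restr {i} s) (restr {i} t) * lpow (A - {i}) (ldiag \<mu>) s t)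
   + (\<Sum>(i, j)\<in>prs A. - \<i> * ?F i j (restr {i, j} s) (restr {i, j} t) * lpow (A - {i, j}) (ldiag \<mu>) s t)"
    if "s \<in> cfgs r A" "t \<in> cfgs r A" for s t
    using lindbladian_decomposition[OF A r ts H that] unfolding G_def
    by (simp only: mtensor_def lpow_restr)
  show ?thesis
  proof
    assume SP: "?S \<and> ?P"
    have "G i (restr {i} s) (restr {i} t) = 0" if "i \<in> A" "s \<in> cfgs r A" "t \<in> cfgs r A" for i s t
      using SP that unfolding G_def op_eq_def by (auto simp: restr_cfgs[of _ r A])
    moreover have "?F i j (restr {i, j} s) (restr {i, j} t) = 0"
      if "i \<in> A" "j \<in> A" "i < j" "s \<in> cfgs r A" "t \<in> cfgs r A" for i j s t
      using SP that unfolding op_eq_def by (auto simp: restr_cfgs[of _ r A])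
    ultimately show ?L
      by (auto simp: op_eq_def dec prs_def intro!: sum.neutral)
  next
    assume L: ?L
    \<comment> \<open>\<open>Tpair\<close> is read off at configurations supported on two sites,
      with the factor -i absorbed, so that the commutator leaves exactly the bracket in
      \<open>\<mu>\<close>.\<close>
    define \<tau> where "\<tau> i j a b c d = - \<i> * Tpair r A r lid H i j ((\<lambda>_. 0)(i := a, j := b)) ((\<lambda>_. 0)(i := c, j := d))" for i j a b c d
    have F: "- \<i> * ?F i j (restr {i, j} s) (restr {i, j} t)
      = \<tau> i j (s i) (s j) (t i) (t j) * (\<mu> (t i) * \<mu> (t j) - \<mu> (s i) * \<mu> (s j))"
      if "i \<noteq> j" "i \<in> B" "j \<in> B" "s \<in> cfgs r B" "t \<in> cfgs r B" for i j s t B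
    proof -
      have c: "restr {i, j} s \<in> cfgs r {i, j}" "restr {i, j} t \<in> cfgs r {i, j}"
        using that restr_cfgs[of _ r B] by auto
      show ?thesis
        by (subst mcomm_diag[where D = "\<lambda>s. \<Prod>i\<in>{i, j}. \<mu> (s i)", OF _ c])
          (use that in \<open>auto simp: lpow_ldiag_cfgs \<tau>_def restr_pair\<close>)
    qed
    have v1: "\<tau> j i b a d c = \<tau> i j a b c d" if "i \<noteq> j" for i j a b c d
      using that by (simp add: \<tau>_def Tpair_commute[of _ _ _ _ _ j i] fun_upd_twist)
    have v2: "(\<Sum>c<r. \<tau> i j a c b c) = 0" if "i \<in> A" "j \<in> A" "i \<noteq> j" "a < r" "b < r" for i j a b
      unfolding \<tau>_def sum_distrib_left[symmetric] using Tpair_partial_trace[OF A that(1-3) r] by simp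
    have v3: "(\<Sum>c<r. G i ((\<lambda>_. 0)(i := c)) ((\<lambda>_. 0)(i := c))) = 0" if "i \<in> A" for i
    proof -
      have "(\<Sum>c<r. G i ((\<lambda>_. 0)(i := c)) ((\<lambda>_. 0)(i := c))) = mtrace r {i} (G i)"
        by (simp add: mtrace_def sum_cfgs_singleton)
      also have "\<dots> = - \<i> * mtrace r {i} (mcomm r {i} (Tsite r A r lid H i) (lpow {i} (ldiag \<mu>)))
         + (\<Sum>\<alpha>\<in>Gam i. mtrace r {i} (dissip r {i} (lpow {i} (L i \<alpha>)) (lpow {i} (ldiag \<mu>))))"
        by (simp add: mtrace_def G_def sum_distrib_left sum_subtractf sum_negf sum.swap[of _ "Gam i"])
      finally show ?thesis by (simp add: mtrace_mcomm mtrace_dissip)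
    qed
    have v4: "(\<Sum>i\<in>A. G i ((\<lambda>_. 0)(i := s i)) ((\<lambda>_. 0)(i := t i)) * lpow (A - {i}) (ldiag \<mu>) s t)
      + (\<Sum>(i, j)\<in>prs A. \<tau> i j (s i) (s j) (t i) (t j) * (\<mu> (t i) * \<mu> (t j) - \<mu> (s i) * \<mu> (s j))
           * lpow (A - {i, j}) (ldiag \<mu>) s t) = 0" if st: "s \<in> cfgs r A" "t \<in> cfgs r A" for s t
    proof -
      have "(\<Sum>(i, j)\<in>prs A. - \<i> * ?F i j (restr {i, j} s) (restr {i, j} t) * lpow (A - {i, j}) (ldiag \<mu>) s t)
        = (\<Sum>(i, j)\<in>prs A. \<tau> i j (s i) (s j) (t i) (t j) * (\<mu> (t i) * \<mu> (t j) - \<mu> (s i) * \<mu> (s j))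
           * lpow (A - {i, j}) (ldiag \<mu>) s t)"
      proof (intro sum.cong refl, clarify)
        fix i j
        assume "(i, j) \<in> prs A"
        then have ij: "i \<noteq> j" "i \<in> A" "j \<in> A" by (auto simp: prs_def)
        show "- \<i> * ?F i j (restr {i, j} s) (restr {i, j} t) * lpow (A - {i, j}) (ldiag \<mu>) s t
          = \<tau> i j (s i) (s j) (t i) (t j) * (\<mu> (t i) * \<mu> (t j) - \<mu> (s i) * \<mu> (s j))
             * lpow (A - {i, j}) (ldiag \<mu>) s t"
          by (simp only: F[OF ij st])
      qed
      then show ?thesis using dec[OF st] L st by (simp add: op_eq_def restr_singleton)
    qed
    have van1: "G i ((\<lambda>_. 0)(i := a)) ((\<lambda>_. 0)(i := b)) = 0" if "i \<in> A" "a < r" "b < r" for i a b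
      by (rule local_terms_vanish(1)[where A = A and r = r and \<mu> = \<mu> and \<tau> = \<tau>
            and g = "\<lambda>i a b. G i ((\<lambda>_. 0)(i := a)) ((\<lambda>_. 0)(i := b))"])
        (fact A r mu v1 v2 v3 v4 that)+
    have van2: "\<tau> i j a b c d * (\<mu> c * \<mu> d - \<mu> a * \<mu> b) = 0"
      if "i \<in> A" "j \<in> A" "i \<noteq> j" "a < r" "b < r" "c < r" "d < r" for i j a b c d
      by (rule local_terms_vanish(2)[where A = A and r = r and \<mu> = \<mu> and \<tau> = \<tau>
            and g = "\<lambda>i a b. G i ((\<lambda>_. 0)(i := a)) ((\<lambda>_. 0)(i := b))"])
        (fact A r mu v1 v2 v3 v4 that)+
    have ?S
      unfolding op_eq_def G_def[symmetric]
    proof (intro ballI)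
      fix i s t
      assume i: "i \<in> A" and st: "s \<in> cfgs r {i}" "t \<in> cfgs r {i}"
      have "G i (restr {i} s) (restr {i} t) = 0"
        unfolding restr_singleton using i st by (intro van1) (auto simp: cfgs_def)
      moreover have "restr {i} s = s" "restr {i} t = t" using st by (auto simp: restr_def cfgs_def)
      ultimately show "G i s t = 0" by simp
    qed
    moreover have ?P
      unfolding op_eq_def
    proof (intro ballI impI)
      fix i j s t
      assume ij: "i \<in> A" "j \<in> A" "i < j" and st: "s \<in> cfgs r {i, j}" "t \<in> cfgs r {i, j}"
      have "restr {i, j} s = s" "restr {i, j} t = t" using st by (auto simp: restr_def cfgs_def)
      then have "- \<i> * ?F i j s t = \<tau> i j (s i) (s j) (t i) (t j) * (\<mu> (t i) * \<mu> (t j) - \<mu> (s i) * \<mu> (s j))"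
        using F[of i j "{i, j}" s t] ij st by simp
      also have "\<dots> = 0" using ij st by (intro van2) (auto simp: cfgs_def)
      finally show "?F i j s t = 0" by simp
    qed
    ultimately show "?S \<and> ?P" by simp
  qed
qed

section \<open>Restriction to the support\<close>

lemma lindbladian_diag:
  assumes A: "finite A" and st: "s \<in> cfgs d A" "t \<in> cfgs d A"
    and R: "\<And>u v. u \<in> cfgs d A \<Longrightarrow> v \<in> cfgs d A \<Longrightarrow> R u v = (if u = v then D u else 0)"
  shows "lindbladian d A H Gam L R s t = - \<i> * (H s t * (D t - D s))
    + (\<Sum>i\<in>A. \<Sum>\<alpha>\<in>Gam i.
        (\<Sum>u\<in>cfgs d A. at_site A i (L i \<alpha>) s u * D u * cnj (at_site A i (L i \<alpha>) t u))
        - 1/2 * ((\<Sum>u\<in>cfgs d A. cnj (at_site A i (L i \<alpha>) u s) * at_site A i (L i \<alpha>) u t) * (D t + D s)))"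
proof -
  have "dissip d A X R s t = (\<Sum>u\<in>cfgs d A. X s u * D u * cnj (X t u))
     - 1/2 * ((\<Sum>u\<in>cfgs d A. cnj (X u s) * X u t) * (D t + D s))" for X
  proof -
    have "mmult d A (mmult d A X R) (madj X) s t = (\<Sum>u\<in>cfgs d A. X s u * D u * cnj (X t u))"
      by (subst mmult_def) (auto intro!: sum.cong simp: mmult_diag_right[OF A, where D = D] R madj_def)
    moreover have "mmult d A (mmult d A (madj X) X) R s t = (\<Sum>u\<in>cfgs d A. cnj (X u s) * X u t) * D t"
      using st R by (subst mmult_diag_right[OF A, where D = D]) (auto simp: mmult_def madj_def)
    moreover have "mmult d A R (mmult d A (madj X) X) s t = D s * (\<Sum>u\<in>cfgs d A. cnj (X u s) * X u t)"
      using st R by (subst mmult_diag_left[OF A, where D = D]) (auto simp: mmult_def madj_def)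
    ultimately show ?thesis by (simp add: dissip_def algebra_simps)
  qed
  then show ?thesis
    unfolding lindbladian_def using mcomm_diag[OF A st R, of H] by simp
qed

text \<open>On a zero of \<open>D\<close> the diagonal entry of the generator is a sum of terms \<open>D u |L s u|\<^sup>2\<close>, so its
  vanishing forces the invariance of the support of \<open>R\<close> under the Lindblad operators.\<close>

lemma lindbladian_support_iff:
  fixes D :: "cfg \<Rightarrow> real" and Gam :: "nat \<Rightarrow> 'a set"
  assumes A: "finite A" and Gam: "\<And>i. i \<in> A \<Longrightarrow> finite (Gam i)"
    and R: "\<And>u v. u \<in> cfgs d A \<Longrightarrow> v \<in> cfgs d A \<Longrightarrow> R u v = (if u = v then complex_of_real (D u) else 0)"
    and D: "\<And>u. u \<in> cfgs d A \<Longrightarrow> D u \<ge> 0"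
    and supp: "cfgs r A = {s \<in> cfgs d A. D s \<noteq> 0}"
    and H: "\<And>s t. s \<in> cfgs d A \<Longrightarrow> t \<in> cfgs d A \<Longrightarrow> H s t = cnj (H t s)"
  shows "op_eq d A (lindbladian d A H Gam L R) (\<lambda>_ _. 0) \<longleftrightarrow>
      (\<forall>i\<in>A. \<forall>\<alpha>\<in>Gam i. \<forall>s\<in>cfgs d A - cfgs r A. \<forall>t\<in>cfgs r A. at_site A i (L i \<alpha>) s t = 0)
    \<and> (\<forall>s\<in>cfgs d A - cfgs r A. \<forall>t\<in>cfgs r A. heff d A H Gam L s t = 0)
    \<and> op_eq r A (lindbladian r A H Gam L R) (\<lambda>_ _. 0)"
    (is "?Z \<longleftrightarrow> ?I \<and> ?E \<and> ?F")
proof -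
  let ?C = "cfgs d A" and ?C' = "cfgs r A"
  define M where "M i \<alpha> = at_site A i (L i \<alpha>)" for i \<alpha>
  let ?Q = "\<lambda>C i \<alpha> s t. \<Sum>u\<in>C. M i \<alpha> s u * of_real (D u) * cnj (M i \<alpha> t u)"
  let ?N = "\<lambda>C i \<alpha> s t. \<Sum>u\<in>C. cnj (M i \<alpha> u s) * M i \<alpha> u t"
  let ?K = "lindbladian d A H Gam L R"
  have finC: "finite ?C" by (rule finite_cfgs[OF A])
  have sub: "?C' \<subseteq> ?C" using supp by auto
  have D0: "D s = 0" if "s \<in> ?C - ?C'" for s using supp that by auto
  have Dn: "D s \<noteq> 0" if "s \<in> ?C'" for s using supp that by auto
  have K: "?K s t = - \<i> * (H s t * (D t - D s)) + (\<Sum>i\<in>A. \<Sum>\<alpha>\<in>Gam i. ?Q ?C i \<alpha> s t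
      - 1/2 * (?N ?C i \<alpha> s t * (D t + D s)))" if "s \<in> ?C" "t \<in> ?C" for s t
    unfolding M_def using lindbladian_diag[OF A that, of R "\<lambda>u. of_real (D u)" H Gam L] R by simp
  have K': "lindbladian r A H Gam L R s t = - \<i> * (H s t * (D t - D s)) + (\<Sum>i\<in>A. \<Sum>\<alpha>\<in>Gam i. ?Q ?C' i \<alpha> s t
      - 1/2 * (?N ?C' i \<alpha> s t * (D t + D s)))" if "s \<in> ?C'" "t \<in> ?C'" for s t
    unfolding M_def using lindbladian_diag[OF A that, of R "\<lambda>u. of_real (D u)" H Gam L] R sub by (simp add: subset_iff)
  have heff: "heff d A H Gam L s t = H s t - \<i> / 2 * (\<Sum>i\<in>A. \<Sum>\<alpha>\<in>Gam i. ?N ?C i \<alpha> s t)" for s t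
    by (simp add: heff_def mmult_def madj_def M_def)
  have inv: ?I if ?Z
  proof (intro ballI)
    fix i \<alpha> s t
    assume i: "i \<in> A" "\<alpha> \<in> Gam i" and s: "s \<in> ?C - ?C'" and t: "t \<in> ?C'"
    let ?q = "\<lambda>i \<alpha>. \<Sum>u\<in>?C. D u * (cmod (M i \<alpha> s u))\<^sup>2"
    have q: "?Q ?C i \<alpha> s s = of_real (?q i \<alpha>)" for i \<alpha>
      unfolding of_real_sum of_real_mult complex_norm_square by (simp add: mult_ac)
    have nn: "?q i \<alpha> \<ge> 0" for i \<alpha> using D by (auto intro!: sum_nonneg)
    have k1: "?K s s = of_real (\<Sum>i\<in>A. \<Sum>\<alpha>\<in>Gam i. ?q i \<alpha>)"
      using K[of s s] s D0[OF s] q by simp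
    have k2: "?K s s = 0" using \<open>?Z\<close> s by (simp add: op_eq_def)
    from trans[OF k1[symmetric] k2] have "(\<Sum>i\<in>A. \<Sum>\<alpha>\<in>Gam i. ?q i \<alpha>) = 0" by (simp only: of_real_eq_0_iff)
    then have "(\<Sum>\<alpha>\<in>Gam i. ?q i \<alpha>) = 0"
      using A i nn by (subst (asm) sum_nonneg_eq_0_iff) (auto intro: sum_nonneg)
    then have "?q i \<alpha> = 0"
      using Gam[OF i(1)] i nn by (subst (asm) sum_nonneg_eq_0_iff) auto
    then have "D t * (cmod (M i \<alpha> s t))\<^sup>2 = 0"
      using D finC t sub by (subst (asm) sum_nonneg_eq_0_iff) auto
    then show "at_site A i (L i \<alpha>) s t = 0" using Dn[OF t] by (simp add: M_def)
  qed
  have main: "?Z \<longleftrightarrow> ?E \<and> ?F" if ?I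
  proof -
    have M0: "M i \<alpha> s t = 0" if "i \<in> A" "\<alpha> \<in> Gam i" "s \<in> ?C - ?C'" "t \<in> ?C'" for i \<alpha> s t
      using \<open>?I\<close> that by (auto simp: M_def)
    \<comment> \<open>For \<open>u\<close> in the support invariance kills one of the two factors;
      for \<open>u\<close> outside it the weight \<open>D u\<close> is zero.\<close>
    have Q0: "?Q ?C i \<alpha> s t = 0" if "i \<in> A" "\<alpha> \<in> Gam i" "s \<in> ?C - ?C' \<or> t \<in> ?C - ?C'" for i \<alpha> s t
    proof (rule sum.neutral, rule ballI)
      fix u assume "u \<in> ?C"
      then show "M i \<alpha> s u * of_real (D u) * cnj (M i \<alpha> t u) = 0"
        using D0[of u] M0[OF that(1,2), of _ u] that(3) by (cases "u \<in> ?C'") auto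
    qed
    \<comment> \<open>With the jump term gone and \<open>D s = 0\<close>, commutator and
      anticommutator both carry the factor \<open>D t\<close> and combine into the effective
      Hamiltonian.\<close>
    have e1: "?K s t = - \<i> * D t * heff d A H Gam L s t" if "s \<in> ?C - ?C'" "t \<in> ?C" for s t
    proof -
      have "?K s t = - \<i> * (H s t * D t) + (\<Sum>i\<in>A. \<Sum>\<alpha>\<in>Gam i. - 1/2 * D t * ?N ?C i \<alpha> s t)"
        using K[of s t] that D0[OF that(1)] Q0 by (simp add: mult.commute)
      also have "\<dots> = - \<i> * D t * heff d A H Gam L s t"
        unfolding heff sum_distrib_left[symmetric] by (simp add: algebra_simps)
      finally show ?thesis .
    qed
    \<comment> \<open>The transposed block: hermiticity of \<open>H\<close> makes it the conjugate
      of an entry of \<open>heff\<close>, so no condition beyond that from \<open>e1\<close>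
      arises.\<close>
    have e2: "?K s t = \<i> * D s * cnj (heff d A H Gam L t s)" if "s \<in> ?C" "t \<in> ?C - ?C'" for s t
    proof -
      have "?K s t = \<i> * (H s t * D s) + (\<Sum>i\<in>A. \<Sum>\<alpha>\<in>Gam i. - 1/2 * D s * ?N ?C i \<alpha> s t)"
        using K[of s t] that D0[OF that(2)] Q0 by (simp add: mult.commute)
      also have "\<dots> = \<i> * D s * cnj (heff d A H Gam L t s)"
        unfolding heff sum_distrib_left[symmetric]
        using H[of s t] that by (simp add: algebra_simps)
      finally show ?thesis .
    qed
    \<comment> \<open>Restricting the inner sums to \<open>cfgs r A\<close> loses nothing: the jump
      sum is cut off by \<open>D\<close>, and the sum in L^dagger L by invariance, which kills
      entries leading out of the support.\<close>
    have e3: "?K s t = lindbladian r A H Gam L R s t" if "s \<in> ?C'" "t \<in> ?C'" for s t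
    proof -
      have "?Q ?C i \<alpha> s t = ?Q ?C' i \<alpha> s t" for i \<alpha>
        using sub finC D0 by (intro sum.mono_neutral_right) auto
      moreover have "?N ?C i \<alpha> s t = ?N ?C' i \<alpha> s t" if "i \<in> A" "\<alpha> \<in> Gam i" for i \<alpha>
        using sub finC M0[OF that] \<open>t \<in> ?C'\<close> by (intro sum.mono_neutral_right) auto
      ultimately show ?thesis using K[OF subsetD[OF sub that(1)] subsetD[OF sub that(2)]] K'[OF that] by simp
    qed
    show ?thesis
    proof
      assume Z: ?Z
      have "heff d A H Gam L s t = 0" if "s \<in> ?C - ?C'" "t \<in> ?C'" for s t
        using e1[of s t] Z that sub Dn[OF that(2)] by (auto simp: op_eq_def)
      moreover have ?F using Z sub by (auto simp: op_eq_def e3[symmetric])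
      ultimately show "?E \<and> ?F" by auto
    next
      assume EF: "?E \<and> ?F"
      show ?Z
        unfolding op_eq_def
      proof (intro ballI)
        fix s t assume st: "s \<in> ?C" "t \<in> ?C"
        show "?K s t = 0"
        proof (cases "s \<in> ?C'")
          case False
          then show ?thesis using e1[of s t] EF st D0[of t] by (cases "t \<in> ?C'") auto
        next
          case True
          then show ?thesis using e2[of s t] e3[of s t] EF st by (cases "t \<in> ?C'") (auto simp: op_eq_def)
        qed
      qed
    qed
  qed
  show ?thesis using inv main by blast
qed

text \<open>In the eigenbasis \<open>V\<close> of \<open>X\<close>, the image consists of the
  vectors whose coefficients vanish where \<open>D\<close> does. Invariance under \<open>Y\<close>
  is therefore the vanishing of one block of V^dagger Y V. The index set \<open>C\<close> is
  abstract so as to cover both a single site and the whole lattice.\<close>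

lemma image_invariance_iff:
  fixes C :: "'b set" and X Y V :: "'b \<Rightarrow> 'b \<Rightarrow> complex" and D :: "'b \<Rightarrow> complex"
  assumes C: "finite C"
    and X: "\<And>a b. a \<in> C \<Longrightarrow> b \<in> C \<Longrightarrow> X a b = (\<Sum>k\<in>C. V a k * D k * cnj (V b k))"
    and V1: "\<And>k l. k \<in> C \<Longrightarrow> l \<in> C \<Longrightarrow> (\<Sum>a\<in>C. cnj (V a k) * V a l) = of_bool (k = l)"
    and V2: "\<And>a b. a \<in> C \<Longrightarrow> b \<in> C \<Longrightarrow> (\<Sum>k\<in>C. V a k * cnj (V b k)) = of_bool (a = b)"
  shows "(\<forall>w. (\<exists>v. \<forall>a\<in>C. w a = (\<Sum>b\<in>C. X a b * v b)) \<longrightarrow>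
          (\<exists>v. \<forall>a\<in>C. (\<Sum>b\<in>C. Y a b * w b) = (\<Sum>b\<in>C. X a b * v b)))
    \<longleftrightarrow> (\<forall>k\<in>C. \<forall>l\<in>C. D k = 0 \<longrightarrow> D l \<noteq> 0 \<longrightarrow> (\<Sum>a\<in>C. \<Sum>b\<in>C. cnj (V a k) * Y a b * V b l) = 0)"
proof -
  define c where "c w k = (\<Sum>a\<in>C. cnj (V a k) * w a)" for w k
  have Xv: "(\<Sum>b\<in>C. X a b * v b) = (\<Sum>k\<in>C. V a k * D k * c v k)" if "a \<in> C" for a v
  proof -
    have "(\<Sum>b\<in>C. X a b * v b) = (\<Sum>b\<in>C. \<Sum>k\<in>C. V a k * D k * (cnj (V b k) * v b))"
      using that by (intro sum.cong) (auto simp: X sum_distrib_right mult.assoc)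
    also have "\<dots> = (\<Sum>k\<in>C. V a k * D k * c v k)"
      unfolding c_def sum_distrib_left by (rule sum.swap)
    finally show ?thesis .
  qed
  have exp: "w a = (\<Sum>k\<in>C. V a k * c w k)" if "a \<in> C" for w a
  proof -
    have "(\<Sum>k\<in>C. V a k * c w k) = (\<Sum>b\<in>C. \<Sum>k\<in>C. V a k * cnj (V b k) * w b)"
      unfolding c_def sum_distrib_left mult.assoc by (rule sum.swap)
    also have "\<dots> = (\<Sum>b\<in>C. if a = b then w b else 0)"
      using that by (intro sum.cong) (auto simp: sum_distrib_right[symmetric] V2)
    finally show ?thesis using that C by simp
  qed
  have cV: "c (\<lambda>a. \<Sum>l\<in>C. V a l * x l) k = x k" if "k \<in> C" for x k
  proof -
    have "c (\<lambda>a. \<Sum>l\<in>C. V a l * x l) k = (\<Sum>l\<in>C. \<Sum>a\<in>C. cnj (V a k) * V a l * x l)"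
      unfolding c_def sum_distrib_left mult.assoc by (rule sum.swap)
    also have "\<dots> = (\<Sum>l\<in>C. if k = l then x l else 0)"
      using that by (intro sum.cong) (auto simp: sum_distrib_right[symmetric] V1)
    finally show ?thesis using that C by simp
  qed
  have c_cong: "c w k = c w' k" if "\<And>a. a \<in> C \<Longrightarrow> w a = w' a" for w w' k
    using that by (auto simp: c_def)
  have img: "(\<exists>v. \<forall>a\<in>C. w a = (\<Sum>b\<in>C. X a b * v b)) \<longleftrightarrow> (\<forall>k\<in>C. D k = 0 \<longrightarrow> c w k = 0)" for w
  proof
    assume "\<exists>v. \<forall>a\<in>C. w a = (\<Sum>b\<in>C. X a b * v b)"
    then obtain v where v: "\<forall>a\<in>C. w a = (\<Sum>b\<in>C. X a b * v b)" by blast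
    have "c w k = D k * c v k" if "k \<in> C" for k
    proof -
      have "c w k = c (\<lambda>a. \<Sum>l\<in>C. V a l * (D l * c v l)) k"
        using v by (intro c_cong) (simp add: Xv mult.assoc)
      then show ?thesis using cV[OF that] by simp
    qed
    then show "\<forall>k\<in>C. D k = 0 \<longrightarrow> c w k = 0" by simp
  next
    assume z: "\<forall>k\<in>C. D k = 0 \<longrightarrow> c w k = 0"
    \<comment> \<open>A preimage is found by dividing the coefficients by \<open>D\<close>. Where
      \<open>D k = 0\<close> the quotient is 0 by convention, which is harmless since
      \<open>c w k\<close> is zero there.\<close>
    define v where "v b = (\<Sum>k\<in>C. V b k * (c w k / D k))" for b
    have cv: "c v k = c w k / D k" if "k \<in> C" for k
      unfolding v_def using cV[OF that] .
    have "w a = (\<Sum>b\<in>C. X a b * v b)" if "a \<in> C" for a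
      using exp[OF that, of w] z by (auto simp: Xv[OF that] cv intro!: sum.cong)
    then show "\<exists>v. \<forall>a\<in>C. w a = (\<Sum>b\<in>C. X a b * v b)" by blast
  qed
  define m where "m k l = (\<Sum>a\<in>C. \<Sum>b\<in>C. cnj (V a k) * Y a b * V b l)" for k l
  have cY: "c (\<lambda>a. \<Sum>b\<in>C. Y a b * w b) k = (\<Sum>l\<in>C. m k l * c w l)" for w k
  proof -
    have "c (\<lambda>a. \<Sum>b\<in>C. Y a b * w b) k = (\<Sum>a\<in>C. \<Sum>b\<in>C. \<Sum>l\<in>C. cnj (V a k) * Y a b * V b l * c w l)"
      unfolding c_def[of "\<lambda>a. \<Sum>b\<in>C. Y a b * w b"]
      by (intro sum.cong refl) (simp add: sum_distrib_left[symmetric] exp[of _ w] mult.assoc)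
    also have "\<dots> = (\<Sum>a\<in>C. \<Sum>l\<in>C. \<Sum>b\<in>C. cnj (V a k) * Y a b * V b l * c w l)"
      by (rule sum.cong[OF refl]) (rule sum.swap)
    also have "\<dots> = (\<Sum>l\<in>C. \<Sum>a\<in>C. \<Sum>b\<in>C. cnj (V a k) * Y a b * V b l * c w l)"
      by (rule sum.swap)
    finally show ?thesis by (simp add: m_def sum_distrib_right)
  qed
  have "(\<forall>w. (\<forall>k\<in>C. D k = 0 \<longrightarrow> c w k = 0) \<longrightarrow> (\<forall>k\<in>C. D k = 0 \<longrightarrow> c (\<lambda>a. \<Sum>b\<in>C. Y a b * w b) k = 0))
    \<longleftrightarrow> (\<forall>k\<in>C. \<forall>l\<in>C. D k = 0 \<longrightarrow> D l \<noteq> 0 \<longrightarrow> m k l = 0)"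
    unfolding cY
  proof (intro iffI allI impI ballI)
    fix k l
    assume h: "\<forall>w. (\<forall>k\<in>C. D k = 0 \<longrightarrow> c w k = 0) \<longrightarrow> (\<forall>k\<in>C. D k = 0 \<longrightarrow> (\<Sum>l\<in>C. m k l * c w l) = 0)"
      and k: "k \<in> C" "l \<in> C" "D k = 0" "D l \<noteq> 0"
    \<comment> \<open>The test vector is the column \<open>l\<close> of \<open>V\<close>; it lies in
      the image because \<open>D l\<close> is nonzero.\<close>
    define w where "w a = (\<Sum>j\<in>C. V a j * of_bool (j = l))" for a
    have cw: "c w j = of_bool (j = l)" if "j \<in> C" for j
      unfolding w_def using cV[OF that] .
    have "(\<Sum>j\<in>C. m k j * c w j) = 0"
      using h[rule_format, of w k] cw k by auto
    moreover have "(\<Sum>j\<in>C. m k j * c w j) = (\<Sum>j\<in>C. if j = l then m k j else 0)"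
      by (intro sum.cong) (auto simp: cw)
    ultimately show "m k l = 0" using k C by simp
  next
    fix w k
    assume "\<forall>k\<in>C. \<forall>l\<in>C. D k = 0 \<longrightarrow> D l \<noteq> 0 \<longrightarrow> m k l = 0" "\<forall>k\<in>C. D k = 0 \<longrightarrow> c w k = 0" "k \<in> C" "D k = 0"
    then show "(\<Sum>l\<in>C. m k l * c w l) = 0"
      by (intro sum.neutral) auto
  qed
  then show ?thesis unfolding img m_def .
qed

section \<open>Covariance under local changes of basis\<close>

lemma cj_embed:
  assumes W: "isometry d d (ladj W)" and A: "finite A" "S \<subseteq> A"
  shows "op_eq d A (cj d A W (embed A S h)) (embed A S (cj d S W h))"
proof -
  let ?T = "A - S"
  have A': "A = S \<union> ?T" "S \<inter> ?T = {}" "finite S" "finite ?T" using A finite_subset by auto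
  have "cj d A W (embed A S h) = mtensor S (cj d S W h) ?T (cj d ?T W (lpow ?T lid))"
    unfolding embed_def by (subst A'(1)) (rule cj_mtensor[OF A'(2-4)])
  \<comment> \<open>The isometry property of \<open>ladj W\<close> is W W^dagger = 1, which
    preserves the identity on the complement of \<open>S\<close>.\<close>
  moreover have "cj d ?T W (lpow ?T lid) s t = lpow ?T lid s t" if "s \<in> cfgs d ?T" "t \<in> cfgs d ?T" for s t
    unfolding cj_lpow[OF A'(4)]
    by (rule lpow_cong_cfgs[OF that])
      (use W in \<open>simp add: isometry_def lmult_assoc, simp add: lmult_def lmult_lid[unfolded lmult_def]\<close>)
  ultimately show ?thesis
    using A by (auto simp: op_eq_def embed_def mtensor_def restr_cfgs)
qed

lemma cj_at_site:
  assumes "isometry d d (ladj W)" "finite A" "i \<in> A"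
  shows "op_eq d A (cj d A W (at_site A i X)) (at_site A i (lmult d (lmult d W X) (ladj W)))"
  unfolding at_site_def using cj_embed[of d W A "{i}" "lpow {i} X"] assms by (simp add: cj_lpow)

lemma cj_sum_list:
  "cj d A W (\<lambda>s t. \<Sum>x\<leftarrow>xs. F x s t) = (\<lambda>s t. \<Sum>x\<leftarrow>xs. cj d A W (F x) s t)"
proof (induction xs)
  case Nil
  then show ?case by (simp add: cj_entry)
next
  case (Cons x xs)
  then show ?case by (simp add: cj_lin)
qed

lemma cj_two_local:
  assumes W: "isometry d d (ladj W)" and A: "finite A"
    and ts: "\<forall>(S, h)\<in>set ts. S \<subseteq> A \<and> card S \<le> 2"
    and H: "op_eq d A H (\<lambda>s t. \<Sum>(S, h)\<leftarrow>ts. embed A S h s t)"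
  shows "op_eq d A (cj d A W H) (\<lambda>s t. \<Sum>(S, h)\<leftarrow>map (\<lambda>(S, h). (S, cj d S W h)) ts. embed A S h s t)"
proof -
  have "cj d A W H = cj d A W (\<lambda>s t. \<Sum>(S, h)\<leftarrow>ts. embed A S h s t)" by (rule cj_cong[OF H])
  also have "\<dots> = (\<lambda>s t. \<Sum>x\<leftarrow>ts. cj d A W (embed A (fst x) (snd x)) s t)"
    unfolding case_prod_beta by (rule cj_sum_list)
  finally have c: "cj d A W H = (\<lambda>s t. \<Sum>x\<leftarrow>ts. cj d A W (embed A (fst x) (snd x)) s t)" .
  have "cj d A W (embed A (fst x) (snd x)) s t = embed A (fst x) (cj d (fst x) W (snd x)) s t"
    if "x \<in> set ts" "s \<in> cfgs d A" "t \<in> cfgs d A" for x s t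
    using cj_embed[OF W A, of "fst x" "snd x"] ts that by (auto simp: op_eq_def)
  then show ?thesis
    unfolding c op_eq_def by (auto simp: comp_def case_prod_beta intro!: arg_cong[where f = sum_list])
qed

text \<open>The generator keeps its form in every product basis. Multiplicativity of the conjugation
  uses W^dagger W = 1, while W W^dagger = 1 keeps single-site operators single-site.\<close>

lemma lindbladian_cj:
  assumes W: "isometry d d W" "isometry d d (ladj W)" and A: "finite A"
    and R: "op_eq d A (cj d A W R) R'"
  shows "op_eq d A (cj d A W (lindbladian d A H Gam L R))
    (lindbladian d A (cj d A W H) Gam (\<lambda>i \<alpha>. lmult d (lmult d W (L i \<alpha>)) (ladj W)) R')"
proof -
  have c: "op_eq d A (mcomm d A (cj d A W H) (cj d A W R)) (mcomm d A (cj d A W H) R')"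
    by (intro mcomm_cong R) (simp add: op_eq_def)
  have D: "op_eq d A (dissip d A (cj d A W (at_site A i (L i \<alpha>))) (cj d A W R))
      (dissip d A (at_site A i (lmult d (lmult d W (L i \<alpha>)) (ladj W))) R')" if "i \<in> A" for i \<alpha>
    by (intro dissip_cong R cj_at_site W A that)
  show ?thesis
    unfolding lindbladian_def cj_lin mcomm_cj[OF W(1) A, symmetric] dissip_cj[OF W(1) A, symmetric]
    using c D by (auto simp: op_eq_def intro!: sum.cong)
qed

lemma heff_cj:
  assumes W: "isometry d d W" "isometry d d (ladj W)" and A: "finite A"
  shows "op_eq d A (cj d A W (heff d A H Gam L))
    (heff d A (cj d A W H) Gam (\<lambda>i \<alpha>. lmult d (lmult d W (L i \<alpha>)) (ladj W)))"
proof -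
  have D: "op_eq d A (mmult d A (madj (cj d A W (at_site A i (L i \<alpha>)))) (cj d A W (at_site A i (L i \<alpha>))))
      (mmult d A (madj (at_site A i (lmult d (lmult d W (L i \<alpha>)) (ladj W)))) (at_site A i (lmult d (lmult d W (L i \<alpha>)) (ladj W))))"
    if "i \<in> A" for i \<alpha>
    by (intro mmult_cong_op_eq madj_cong cj_at_site W A that)
  show ?thesis
    unfolding heff_def cj_lin mmult_cj[OF W(1) A, symmetric] madj_cj[symmetric]
    using D by (auto simp: op_eq_def intro!: sum.cong)
qed

lemma lmult_lid_middle: "lmult r (lmult r U lid) V = lmult r U V"
  by (intro ext) (simp add: lmult_def lmult_lid[unfolded lmult_def])

text \<open>The identity of the image is U U^dagger, to which \<open>cj\<close> sends
  \<open>lid\<close>. With the trace identities this turns the primed map, computed in C^d, into the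
  ordinary map in C^r.\<close>

lemma Tsite_cj:
  assumes U: "isometry d r U" and A: "finite A" "i \<in> A"
  shows "Tsite d A c (lmult r U (ladj U)) (cj r A U Y) i = cj r {i} U (Tsite r A c lid Y i)"
proof -
  have T: "Tsite d A c e X i = (\<lambda>s t. ptrace d A {i} X s t / of_nat c ^ (card A - 1)
      - mtrace d A X / of_nat c ^ card A * lpow {i} e s t)" for d e X
    by (simp add: Tsite_def lpow_def)
  show ?thesis
    unfolding T cj_lin cj_lpow[OF finite.insertI[OF finite.emptyI]] lmult_lid_middle
    using A by (simp add: ptrace_cj[OF U A(1)] mtrace_cj[OF U A(1)])
qed

lemma Tpair_cj:
  assumes U: "isometry d r U" and A: "finite A" "i \<in> A" "j \<in> A" "i \<noteq> j"
  shows "Tpair d A c (lmult r U (ladj U)) (cj r A U Y) i j = cj r {i, j} U (Tpair r A c lid Y i j)"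
proof -
  have T: "Tpair d A c e X i j = (\<lambda>s t. ptrace d A {i, j} X s t / of_nat c ^ (card A - 2)
      - mtensor {i} (ptrace d A {i} X) {j} (lpow {j} e) s t / of_nat c ^ (card A - 1)
      - mtensor {j} (ptrace d A {j} X) {i} (lpow {i} e) s t / of_nat c ^ (card A - 1)
      + mtrace d A X / of_nat c ^ card A * lpow {i, j} e s t)" for d e X
    using A by (intro ext) (simp add: Tpair_def mtensor_def lpow_restr, simp add: lpow_def mult.commute)
  have m: "cj r {i, j} U (mtensor {i} X {j} Z) = mtensor {i} (cj r {i} U X) {j} (cj r {j} U Z)"
    "cj r {i, j} U (mtensor {j} X {i} Z) = mtensor {j} (cj r {j} U X) {i} (cj r {i} U Z)" for X Z
    using cj_mtensor[of "{i}" "{j}" r U X Z] cj_mtensor[of "{j}" "{i}" r U X Z] A(4)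
    by (simp_all add: insert_commute)
  show ?thesis
    unfolding T cj_lin m
    using A by (simp add: ptrace_cj[OF U A(1)] mtrace_cj[OF U A(1)] cj_lpow lmult_lid_middle)
qed

section \<open>Reduction of a general density matrix to its eigenbasis\<close>

theorem theorem1:
  fixes d n r :: nat and \<rho> :: lop and \<psi> :: "nat \<Rightarrow> lvec" and lam :: "nat \<Rightarrow> real"
    and H :: mop and Gam :: "nat \<Rightarrow> 'a set" and L :: "nat \<Rightarrow> 'a \<Rightarrow> lop"
  assumes dens: "density_matrix d \<rho>"
    and orthonormal: "\<forall>k<d. \<forall>l<d. linner d (\<psi> k) (\<psi> l) = (if k = l then 1 else 0)"
    and spectral: "leq d \<rho> (\<lambda>a b. \<Sum>k<d. complex_of_real (lam k) * \<psi> k a * cnj (\<psi> k b))"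
    and rank: "r \<le> d" "\<forall>k<r. lam k \<noteq> 0" "\<forall>k. r \<le> k \<and> k < d \<longrightarrow> lam k = 0"
    and Gam_fin: "\<forall>i\<in>{1..n}. finite (Gam i)"
    and H_herm: "\<forall>s\<in>cfgs d {1..n}. \<forall>t\<in>cfgs d {1..n}. H s t = cnj (H t s)"
    and H_2local: "\<exists>ts :: (nat set \<times> mop) list.
        (\<forall>(S, h)\<in>set ts. S \<subseteq> {1..n} \<and> card S \<le> 2)
        \<and> op_eq d {1..n} H (\<lambda>s t. \<Sum>(S, h)\<leftarrow>ts. embed {1..n} S h s t)"
  shows "op_eq d {1..n} (lindbladian d {1..n} H Gam L (lpow {1..n} \<rho>)) (\<lambda>_ _. 0)
    \<longleftrightarrow>
      (\<forall>i\<in>{1..n}. \<forall>\<alpha>\<in>Gam i. \<forall>w\<in>limg d \<rho>. lapply d (L i \<alpha>) w \<in> limg d \<rho>)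
    \<and> (\<forall>w\<in>mimg d {1..n} (lpow {1..n} \<rho>).
          mapply d {1..n} (heff d {1..n} H Gam L) w \<in> mimg d {1..n} (lpow {1..n} \<rho>))
    \<and> (\<forall>i\<in>{1..n}. op_eq d {i}
          (\<lambda>s t. - \<i> * mcomm d {i}
               (Tsite d {1..n} r (lproj \<psi> r)
                  (mmult d {1..n} (mmult d {1..n} (lpow {1..n} (lproj \<psi> r)) H) (lpow {1..n} (lproj \<psi> r))) i)
               (lpow {i} \<rho>) s t
             + (\<Sum>\<alpha>\<in>Gam i. dissip d {i}
                  (lpow {i} (lmult d (lmult d (lproj \<psi> r) (L i \<alpha>)) (lproj \<psi> r))) (lpow {i} \<rho>) s t))
          (\<lambda>_ _. 0))
    \<and> (\<forall>i\<in>{1..n}. \<forall>j\<in>{1..n}. i < j \<longrightarrow> op_eq d {i, j}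
          (mcomm d {i, j}
             (Tpair d {1..n} r (lproj \<psi> r)
                (mmult d {1..n} (mmult d {1..n} (lpow {1..n} (lproj \<psi> r)) H) (lpow {1..n} (lproj \<psi> r))) i j)
             (lpow {i, j} \<rho>))
          (\<lambda>_ _. 0))"
proof -
  define A where "A = {1..n}"
  \<comment> \<open>The columns of \<open>U\<close> are the eigenvectors, so \<open>H'\<close> and
    \<open>l\<close> are the Hamiltonian and the Lindblad operators in the eigenbasis, and
    \<open>D\<close> lists the eigenvalues of the tensor power of \<open>\<rho>\<close>.\<close>
  define U :: lop where "U = (\<lambda>a k. \<psi> k a)"
  define \<mu> where "\<mu> k = complex_of_real (lam k)" for k
  define H' where "H' = cj d A (ladj U) H"
  define l where "l i \<alpha> = lmult d (lmult d (ladj U) (L i \<alpha>)) U" for i \<alpha>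
  define D where "D s = (\<Prod>i\<in>A. lam (s i))" for s :: cfg
  have A: "finite A" by (simp add: A_def)
  have psi: "\<psi> k a = U a k" for k a by (simp add: U_def)
  have U: "isometry d d U"
    using orthonormal by (simp add: isometry_def lmult_def ladj_def U_def lid_def linner_def)
  have U': "isometry d d (ladj U)" by (rule isometry_ladj[OF U])
  have Ur: "isometry d r U" by (rule isometry_mono[OF U rank(1)])
  have P: "lproj \<psi> r = lmult r U (ladj U)"
    by (simp add: lproj_def lmult_def U_def ladj_def)
  have diag: "lmult m (lmult m U (ldiag \<mu>)) (ladj U) a b = (\<Sum>k<m. U a k * \<mu> k * cnj (U b k))" for m a b
    by (simp add: lmult_def ldiag_def ladj_def if_distrib[of "\<lambda>x. _ * x"] cong: if_cong)
  have rho_d: "\<rho> a b = lmult d (lmult d U (ldiag \<mu>)) (ladj U) a b" if "a < d" "b < d" for a b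
    using spectral that unfolding diag by (simp add: leq_def U_def \<mu>_def mult_ac)
  \<comment> \<open>Zero eigenvalues do not contribute, so \<open>\<rho>\<close> is also the image
    of an \<open>r\<close> by \<open>r\<close> diagonal matrix under the isometry given by the first
    \<open>r\<close> columns.\<close>
  have rho_r: "\<rho> a b = lmult r (lmult r U (ldiag \<mu>)) (ladj U) a b" if "a < d" "b < d" for a b
    unfolding rho_d[OF that] diag using rank
    by (intro sum.mono_neutral_right) (auto simp: \<mu>_def)
  have R_d: "op_eq d B (lpow B \<rho>) (cj d B U (lpow B (ldiag \<mu>)))" if "finite B" for B
    using that rho_d by (auto simp: op_eq_def cj_lpow intro: lpow_cong_cfgs)
  have R_r: "op_eq d B (lpow B \<rho>) (cj r B U (lpow B (ldiag \<mu>)))" if "finite B" for B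
    using that rho_r by (auto simp: op_eq_def cj_lpow intro: lpow_cong_cfgs)
  have UU: "(\<Sum>a<d. cnj (U a k) * U a j) = of_bool (k = j)" if "k < d" "j < d" for k j
    using orthonormal that by (simp add: U_def linner_def)
  \<comment> \<open>\<open>lam k\<close> is the expectation of \<open>\<rho>\<close> in the
    eigenvector \<open>\<psi> k\<close>, so positivity of \<open>\<rho>\<close> applies.\<close>
  have lam_nonneg: "lam k \<ge> 0" if k: "k < d" for k
  proof -
    have "lapply d \<rho> (\<psi> k) a = \<mu> k * \<psi> k a" if a: "a < d" for a
    proof -
      have "lapply d \<rho> (\<psi> k) a = (\<Sum>b<d. \<Sum>j<d. U a j * \<mu> j * (cnj (U b j) * U b k))"
        unfolding lapply_def using a by (intro sum.cong refl) (simp add: rho_d diag sum_distrib_right mult.assoc psi)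
      also have "\<dots> = (\<Sum>j<d. U a j * \<mu> j * (\<Sum>b<d. cnj (U b j) * U b k))"
        unfolding sum_distrib_left by (rule sum.swap)
      also have "\<dots> = (\<Sum>j<d. if j = k then U a j * \<mu> j else 0)"
        using k by (intro sum.cong) (auto simp: UU)
      finally show ?thesis using k by (simp add: U_def mult.commute)
    qed
    then have "linner d (\<psi> k) (lapply d \<rho> (\<psi> k)) = \<mu> k * linner d (\<psi> k) (\<psi> k)"
      by (simp add: linner_def sum_distrib_left mult_ac)
    then have "linner d (\<psi> k) (lapply d \<rho> (\<psi> k)) = \<mu> k" using orthonormal k by simp
    moreover have "0 \<le> Re (linner d (\<psi> k) (lapply d \<rho> (\<psi> k)))"
      using dens unfolding density_matrix_def by blast
    ultimately show ?thesis by (simp add: \<mu>_def)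
  qed
  have mu_sum: "(\<Sum>k<r. \<mu> k) = 1"
  proof -
    have "ltrace d \<rho> = 1" using dens unfolding density_matrix_def by blast
    then have "1 = (\<Sum>a<d. \<rho> a a)" by (simp add: ltrace_def)
    also have "\<dots> = (\<Sum>a<d. \<Sum>k<r. \<mu> k * (cnj (U a k) * U a k))"
      by (intro sum.cong refl) (simp add: rho_r diag mult_ac)
    also have "\<dots> = (\<Sum>k<r. \<mu> k * (\<Sum>a<d. cnj (U a k) * U a k))"
      unfolding sum_distrib_left by (rule sum.swap)
    also have "\<dots> = (\<Sum>k<r. \<mu> k)" using rank(1) by (intro sum.cong) (auto simp: UU)
    finally show ?thesis by simp
  qed
  \<comment> \<open>Trace one excludes rank 0; the division by powers of \<open>r\<close> and the
    reference configuration 0 rely on this.\<close>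
  have r: "r > 0" using mu_sum by (cases r) auto
  have mu_nz: "\<mu> k \<noteq> 0" if "k < r" for k using rank that by (simp add: \<mu>_def)
  have mu_iff: "\<mu> k \<noteq> 0 \<longleftrightarrow> k < r" if "k < d" for k
    using rank that by (auto simp: \<mu>_def not_less[symmetric])
  have D_nonneg: "D s \<ge> 0" if "s \<in> cfgs d A" for s
    using that lam_nonneg by (auto simp: D_def cfgs_def intro!: prod_nonneg)
  have supp: "cfgs r A = {s \<in> cfgs d A. D s \<noteq> 0}"
    using A rank mu_iff by (auto simp: cfgs_def D_def \<mu>_def) (meson order_less_le_trans)+
  have R_diag: "lpow A (ldiag \<mu>) s t = (if s = t then complex_of_real (D s) else 0)"
    if "s \<in> cfgs d A" "t \<in> cfgs d A" for s t
    using lpow_ldiag_cfgs[OF A that] by (simp add: D_def \<mu>_def)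
  obtain ts :: "(nat set \<times> mop) list" where ts: "\<forall>(S, h)\<in>set ts. S \<subseteq> A \<and> card S \<le> 2"
    and Hts: "op_eq d A H (\<lambda>s t. \<Sum>(S, h)\<leftarrow>ts. embed A S h s t)"
    using H_2local unfolding A_def by blast
  let ?ts = "map (\<lambda>(S, h). (S, cj d S (ladj U) h)) ts"
  have ts': "\<forall>(S, h)\<in>set ?ts. S \<subseteq> A \<and> card S \<le> 2" using ts by auto
  have U2: "isometry d d (ladj (ladj U))" using U by simp
  have "op_eq d A H' (\<lambda>s t. \<Sum>(S, h)\<leftarrow>?ts. embed A S h s t)"
    unfolding H'_def by (rule cj_two_local[OF U2 A ts Hts])
  then have Hts': "op_eq r A H' (\<lambda>s t. \<Sum>(S, h)\<leftarrow>?ts. embed A S h s t)"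
    using cfgs_mono[OF rank(1)] unfolding op_eq_def by blast
  have H'_herm: "H' s t = cnj (H' t s)" for s t
  proof -
    have "op_eq d A (madj H) H" unfolding op_eq_def madj_def A_def
      by (intro ballI) (rule sym, use H_herm in blast)
    then have "madj H' = H'" unfolding H'_def madj_cj by (rule cj_cong)
    from fun_cong[OF fun_cong[OF this, of s], of t] show ?thesis unfolding madj_def by (rule sym)
  qed

  let ?Z = "op_eq d A (lindbladian d A H Gam L (lpow A \<rho>)) (\<lambda>_ _. 0)"
  let ?inv = "\<forall>i\<in>A. \<forall>\<alpha>\<in>Gam i. \<forall>s\<in>cfgs d A - cfgs r A. \<forall>t\<in>cfgs r A. at_site A i (l i \<alpha>) s t = 0"
  let ?heff = "\<forall>s\<in>cfgs d A - cfgs r A. \<forall>t\<in>cfgs r A. heff d A H' Gam l s t = 0"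
  let ?one = "\<lambda>i. op_eq r {i} (\<lambda>s t. - \<i> * mcomm r {i} (Tsite r A r lid H' i) (lpow {i} (ldiag \<mu>)) s t
             + (\<Sum>\<alpha>\<in>Gam i. dissip r {i} (lpow {i} (l i \<alpha>)) (lpow {i} (ldiag \<mu>)) s t)) (\<lambda>_ _. 0)"
  let ?two = "\<lambda>i j. op_eq r {i, j} (mcomm r {i, j} (Tpair r A r lid H' i j) (lpow {i, j} (ldiag \<mu>))) (\<lambda>_ _. 0)"
  let ?X = "mmult d A (mmult d A (lpow A (lproj \<psi> r)) H) (lpow A (lproj \<psi> r))"

  \<comment> \<open>Three reductions in turn: unitary change of basis, separation of the support,
    and the faithful case on the support.\<close>
  have Z_iff: "?Z \<longleftrightarrow> ?inv \<and> ?heff \<and> (\<forall>i\<in>A. ?one i) \<and> (\<forall>i\<in>A. \<forall>j\<in>A. i < j \<longrightarrow> ?two i j)"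
  proof -
    have R': "op_eq d A (cj d A (ladj U) (lpow A \<rho>)) (lpow A (ldiag \<mu>))"
      unfolding cj_cong[OF R_d[OF A]] op_eq_def using cj_cj[OF U A] by blast
    have "op_eq d A (cj d A (ladj U) (lindbladian d A H Gam L (lpow A \<rho>)))
      (lindbladian d A H' Gam l (lpow A (ldiag \<mu>)))"
      using lindbladian_cj[OF U' U2 A R', of H Gam L] by (simp add: H'_def l_def[abs_def])
    then have "?Z \<longleftrightarrow> op_eq d A (lindbladian d A H' Gam l (lpow A (ldiag \<mu>))) (\<lambda>_ _. 0)"
      using op_eq_cj_iff[OF U' A, of "lindbladian d A H Gam L (lpow A \<rho>)"] by (simp add: op_eq_def)
    also have "\<dots> \<longleftrightarrow> ?inv \<and> ?heff \<and> op_eq r A (lindbladian r A H' Gam l (lpow A (ldiag \<mu>))) (\<lambda>_ _. 0)"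
      by (rule lindbladian_support_iff[OF A _ R_diag D_nonneg supp H'_herm])
        (use Gam_fin in \<open>auto simp: A_def\<close>)
    also have "op_eq r A (lindbladian r A H' Gam l (lpow A (ldiag \<mu>))) (\<lambda>_ _. 0)
      \<longleftrightarrow> (\<forall>i\<in>A. ?one i) \<and> (\<forall>i\<in>A. \<forall>j\<in>A. i < j \<longrightarrow> ?two i j)"
      by (rule lindbladian_faithful_iff[OF A r _ _ ts' Hts']) (use mu_nz mu_sum in auto)
    finally show ?thesis .
  qed

  have inv_iff: "?inv \<longleftrightarrow> (\<forall>i\<in>A. \<forall>\<alpha>\<in>Gam i. \<forall>w\<in>limg d \<rho>. lapply d (L i \<alpha>) w \<in> limg d \<rho>)"
  proof -
    have "(\<forall>s\<in>cfgs d A - cfgs r A. \<forall>t\<in>cfgs r A. at_site A i (l i \<alpha>) s t = 0)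
      \<longleftrightarrow> (\<forall>w\<in>limg d \<rho>. lapply d (L i \<alpha>) w \<in> limg d \<rho>)" if i: "i \<in> A" for i \<alpha>
    proof -
      have "(\<forall>w\<in>limg d \<rho>. lapply d (L i \<alpha>) w \<in> limg d \<rho>) \<longleftrightarrow>
        (\<forall>w. (\<exists>v. \<forall>a\<in>{..<d}. w a = (\<Sum>b<d. \<rho> a b * v b)) \<longrightarrow>
          (\<exists>v. \<forall>a\<in>{..<d}. (\<Sum>b<d. L i \<alpha> a b * w b) = (\<Sum>b<d. \<rho> a b * v b)))"
        by (simp add: limg_def lapply_def Ball_def)
      also have "\<dots> \<longleftrightarrow> (\<forall>k\<in>{..<d}. \<forall>j\<in>{..<d}. \<mu> k = 0 \<longrightarrow> \<mu> j \<noteq> 0 \<longrightarrow>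
          (\<Sum>a<d. \<Sum>b<d. cnj (U a k) * L i \<alpha> a b * U b j) = 0)"
      proof (rule image_invariance_iff)
        show "(\<Sum>k<d. U a k * cnj (U b k)) = of_bool (a = b)" if "a \<in> {..<d}" "b \<in> {..<d}" for a b
          using U' that by (simp add: isometry_def lmult_def lid_def ladj_def)
      qed (simp_all add: rho_d diag UU)
      also have "\<dots> \<longleftrightarrow> (\<forall>a b. r \<le> a \<longrightarrow> a < d \<longrightarrow> b < r \<longrightarrow> l i \<alpha> a b = 0)"
      proof -
        have lk: "l i \<alpha> k j = (\<Sum>a<d. \<Sum>b<d. cnj (U a k) * L i \<alpha> a b * U b j)" for k j
          unfolding l_def lmult_def ladj_def sum_distrib_right by (rule sum.swap)
        have "\<mu> k = 0 \<longleftrightarrow> r \<le> k" if "k < d" for k using mu_iff[OF that] by auto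
        then show ?thesis
          unfolding lk[symmetric] using rank(1) by (metis lessThan_iff not_less order_less_le_trans)
      qed
      \<comment> \<open>A single-site operator has nonzero entries only between configurations that
        agree off \<open>i\<close>; between these, leaving the support means leaving it at
        \<open>i\<close>.\<close>
      also have "\<dots> \<longleftrightarrow> (\<forall>s\<in>cfgs d A - cfgs r A. \<forall>t\<in>cfgs r A. at_site A i (l i \<alpha>) s t = 0)"
      proof -
        have e: "at_site A i X s t = X (s i) (t i) * of_bool (\<forall>k\<in>A - {i}. s k = t k)" for X s t
          using A by (simp add: at_site_def embed_entry lpow_def restr_def)
        show ?thesis
          unfolding e
        proof (intro iffI ballI allI impI)
          fix s t
          assume h: "\<forall>a b. r \<le> a \<longrightarrow> a < d \<longrightarrow> b < r \<longrightarrow> l i \<alpha> a b = 0"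
            and s: "s \<in> cfgs d A - cfgs r A" and t: "t \<in> cfgs r A"
          show "l i \<alpha> (s i) (t i) * of_bool (\<forall>k\<in>A - {i}. s k = t k) = 0"
          proof (cases "\<forall>k\<in>A - {i}. s k = t k")
            case True
            obtain k where k: "k \<in> A" "\<not> s k < r" using s by (auto simp: cfgs_def)
            moreover have "t k < r" using t k by (simp add: cfgs_def)
            ultimately have "k = i" using True by force
            then show ?thesis using h s t i k by (auto simp: cfgs_def)
          qed simp
        next
          fix a b
          assume h: "\<forall>s\<in>cfgs d A - cfgs r A. \<forall>t\<in>cfgs r A. l i \<alpha> (s i) (t i) * of_bool (\<forall>k\<in>A - {i}. s k = t k) = 0"
            and ab: "r \<le> a" "a < d" "b < r"
          \<comment> \<open>Index 0 is below \<open>r\<close>, so the padding does not affect which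
            of the two configurations lies in the support.\<close>
          have "(\<lambda>_. 0)(i := a) \<in> cfgs d A - cfgs r A" "(\<lambda>_. 0)(i := b) \<in> cfgs r A"
            using ab i r by (auto simp: cfgs_def)
          from h[rule_format, OF this] show "l i \<alpha> a b = 0" by simp
        qed
      qed
      finally show ?thesis by simp
    qed
    then show ?thesis by blast
  qed

  have heff_iff: "?heff \<longleftrightarrow> (\<forall>w\<in>mimg d A (lpow A \<rho>). mapply d A (heff d A H Gam L) w \<in> mimg d A (lpow A \<rho>))"
  proof -
    let ?C = "cfgs d A" and ?V = "lpow A U" and ?Y = "heff d A H Gam L"
    have W: "lpow A (ladj U) s a = cnj (?V a s)" for s a
      by (simp add: lpow_def ladj_def)
    have "(\<forall>w\<in>mimg d A (lpow A \<rho>). mapply d A ?Y w \<in> mimg d A (lpow A \<rho>)) \<longleftrightarrow>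
        (\<forall>w. (\<exists>v. \<forall>a\<in>?C. w a = (\<Sum>b\<in>?C. lpow A \<rho> a b * v b)) \<longrightarrow>
          (\<exists>v. \<forall>a\<in>?C. (\<Sum>b\<in>?C. ?Y a b * w b) = (\<Sum>b\<in>?C. lpow A \<rho> a b * v b)))"
      by (simp add: mimg_def mapply_def Ball_def)
    also have "\<dots> \<longleftrightarrow> (\<forall>k\<in>?C. \<forall>j\<in>?C. complex_of_real (D k) = 0 \<longrightarrow> complex_of_real (D j) \<noteq> 0 \<longrightarrow>
          (\<Sum>a\<in>?C. \<Sum>b\<in>?C. cnj (?V a k) * ?Y a b * ?V b j) = 0)"
    proof (rule image_invariance_iff)
      show "finite ?C" by (rule finite_cfgs[OF A])
      fix a b assume ab: "a \<in> ?C" "b \<in> ?C"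
      show "(\<Sum>k\<in>?C. cnj (?V k a) * ?V k b) = of_bool (a = b)"
        using isometry_lpow[OF U A ab] lpow_lid_cfgs[OF A ab] by (simp add: mmult_def W)
      show "(\<Sum>k\<in>?C. ?V a k * cnj (?V b k)) = of_bool (a = b)"
        using isometry_lpow[OF U' A ab] lpow_lid_cfgs[OF A ab] by (simp add: mmult_def W)
      have "lpow A \<rho> a b = cj d A U (lpow A (ldiag \<mu>)) a b"
        using R_d[OF A] ab by (simp add: op_eq_def)
      also have "\<dots> = (\<Sum>k\<in>?C. mmult d A ?V (lpow A (ldiag \<mu>)) a k * cnj (?V b k))"
        by (simp add: cj_def mmult_def[of _ _ "mmult _ _ _ _"] W)
      also have "\<dots> = (\<Sum>k\<in>?C. ?V a k * of_real (D k) * cnj (?V b k))"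
        by (intro sum.cong refl arg_cong2[where f = times] mmult_diag_right[OF A]) (auto simp: R_diag)
      finally show "lpow A \<rho> a b = (\<Sum>k\<in>?C. ?V a k * of_real (D k) * cnj (?V b k))" .
    qed
    also have "\<dots> \<longleftrightarrow> (\<forall>k\<in>?C. \<forall>j\<in>?C. D k = 0 \<longrightarrow> D j \<noteq> 0 \<longrightarrow> cj d A (ladj U) ?Y k j = 0)"
      by (simp add: cj_entry W)
    also have "\<dots> \<longleftrightarrow> (\<forall>k\<in>?C. \<forall>j\<in>?C. D k = 0 \<longrightarrow> D j \<noteq> 0 \<longrightarrow> heff d A H' Gam l k j = 0)"
      using heff_cj[OF U' U2 A, of H Gam L] by (simp add: op_eq_def H'_def l_def[abs_def])
    also have "\<dots> \<longleftrightarrow> ?heff" unfolding supp by auto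
    finally show ?thesis by simp
  qed

  \<comment> \<open>With V the tensor power of the first \<open>r\<close> columns, the projection is
    V V^dagger. The compressed Hamiltonian is then V (V^dagger H V) V^dagger, whose inner bracket is
    the \<open>r\<close>-dimensional block of \<open>H'\<close>.\<close>
  have X: "?X = cj r A U H'"
    unfolding P H'_def cj_def mmult_lpow[OF A, symmetric] by (simp add: mmult_assoc)
  \<comment> \<open>Every ingredient of condition (iii) agrees with the image under
    \<open>cj r {i} U\<close> of its counterpart on C^r, so \<open>op_eq_cj_iff\<close> transfers
    the equation.\<close>
  have one_iff: "?one i \<longleftrightarrow> op_eq d {i} (\<lambda>s t. - \<i> * mcomm d {i} (Tsite d A r (lproj \<psi> r) ?X i) (lpow {i} \<rho>) s t
             + (\<Sum>\<alpha>\<in>Gam i. dissip d {i} (lpow {i} (lmult d (lmult d (lproj \<psi> r) (L i \<alpha>)) (lproj \<psi> r))) (lpow {i} \<rho>) s t))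
          (\<lambda>_ _. 0)" if i: "i \<in> A" for i
  proof -
    have fi: "finite {i}" by simp
    have T: "Tsite d A r (lproj \<psi> r) ?X i = cj r {i} U (Tsite r A r lid H' i)"
      unfolding X unfolding P by (rule Tsite_cj[OF Ur A i])
    have lL: "lpow {i} (lmult d (lmult d (lproj \<psi> r) (L i \<alpha>)) (lproj \<psi> r)) = cj r {i} U (lpow {i} (l i \<alpha>))" for \<alpha>
      unfolding cj_lpow[OF fi] P l_def by (simp add: lmult_assoc)
    have refl: "op_eq d {i} Y Y" for Y by (simp add: op_eq_def)
    have c: "op_eq d {i} (mcomm d {i} (Tsite d A r (lproj \<psi> r) ?X i) (lpow {i} \<rho>)) (cj r {i} U (mcomm r {i} (Tsite r A r lid H' i) (lpow {i} (ldiag \<mu>))))"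
      unfolding T mcomm_cj[OF Ur fi, symmetric] by (intro mcomm_cong refl R_r fi)
    have D: "op_eq d {i} (dissip d {i} (lpow {i} (lmult d (lmult d (lproj \<psi> r) (L i \<alpha>)) (lproj \<psi> r))) (lpow {i} \<rho>))
        (cj r {i} U (dissip r {i} (lpow {i} (l i \<alpha>)) (lpow {i} (ldiag \<mu>))))" for \<alpha>
      unfolding lL dissip_cj[OF Ur fi, symmetric] by (intro dissip_cong refl R_r fi)
    show ?thesis
      unfolding op_eq_cj_iff[OF Ur fi, symmetric] cj_lin using c D by (simp add: op_eq_def)
  qed
  have two_iff: "?two i j \<longleftrightarrow> op_eq d {i, j} (mcomm d {i, j} (Tpair d A r (lproj \<psi> r) ?X i j) (lpow {i, j} \<rho>)) (\<lambda>_ _. 0)"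
    if ij: "i \<in> A" "j \<in> A" "i < j" for i j
  proof -
    have fi: "finite {i, j}" by simp
    have T: "Tpair d A r (lproj \<psi> r) ?X i j = cj r {i, j} U (Tpair r A r lid H' i j)"
      unfolding X unfolding P using ij by (intro Tpair_cj[OF Ur A]) auto
    have "op_eq d {i, j} (mcomm d {i, j} (Tpair d A r (lproj \<psi> r) ?X i j) (lpow {i, j} \<rho>))
       (cj r {i, j} U (mcomm r {i, j} (Tpair r A r lid H' i j) (lpow {i, j} (ldiag \<mu>))))"
      unfolding T mcomm_cj[OF Ur fi, symmetric]
      by (intro mcomm_cong R_r fi) (simp add: op_eq_def)
    then show ?thesis
      unfolding op_eq_cj_iff[OF Ur fi, symmetric] by (simp add: op_eq_def)
  qed
  show ?thesis
    unfolding A_def[symmetric] Z_iff inv_iff heff_iff using one_iff two_iff by blast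
qed

end
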